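(* Let $(\Omega,\mathsf{F},\mathbb{P})$ be a probability space and let $(\mathcal{H},d)$ be a separable Hadamard space. Let $(X_i)_{i\ge1}$ be an i.i.d. sequence of random variables $X_i\in L^1(\Omega,\mathcal{H},\mathbb{P})$ and fix $o\in\mathcal{H}$. Then for any $\varepsilon>0$ and any integer $m\ge1$: \[ \mathbb{P}\left(\sup_{n\ge m}d\left(s_n,\mathbb{E}[X_1]\right)>\varepsilon\right)\le\frac{6}{\varepsilon}\left(\frac{\sqrt{\mathbb{E}[d(o,X_1)]}}{m^{1/2}}+U_{\mathbb{P}}(m^{1/8})\right)+\frac{72}{\min\{\varepsilon^2,1\}\,m^{1/4}}, \] where $s_n$ is the $n$-th inductive mean of $X_1,\dots,X_n$ and $U_{\mathbb{P}}(x):=\mathbb{E}[d(o,X_1)\mathbf{1}_{d(o,X_1)\ge x}]$.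
   Context: A Hadamard space is a complete metric space $(\mathcal{H},d)$ in which any two points are joined by a geodesic (an isometric embedding $\gamma:[0,l]\to\mathcal{H}$) and such that $d^2(\gamma(tl),x)\le(1-t)d^2(\gamma(0),x)+td^2(\gamma(l),x)-t(1-t)d^2(\gamma(0),\gamma(l))$ for all $x\in\mathcal{H}$, $t\in[0,1]$ and all geodesics $\gamma:[0,l]\to\mathcal{H}$. Geodesics between two points are unique, and $(1-t)x\oplus ty$ denotes the point $\gamma(tl)$ on the geodesic $\gamma:[0,l]\to\mathcal{H}$ with $\gamma(0)=x$, $\gamma(l)=y$. $\mathcal{H}$-valued random variables are Borel measurable maps. $X\in L^1(\Omega,\mathcal{H},\mathbb{P})$ means $\mathbb{E}[d(X,z)]<\infty$ for some/any $z\in\mathcal{H}$. The expectation of such $X$ is the barycenter of its distribution: $\mathbb{E}[X]:=\mathrm{argmin}_{z\in\mathcal{H}}\mathbb{E}[d^2(z,X)-d^2(y,X)]$, a unique point that is independent of $y\in\mathcal{H}$. The inductive means of a sequence $(x_i)\subseteq\mathcal{H}$ are $s_1:=x_1$ and $s_n:=(1-\frac1n)s_{n-1}\oplus\frac1n x_n$ (written $\frac1n\overrightarrow{\sum}_{i=1,\dots,n}x_i$ in the paper). *)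

theory Defs
  imports "HOL-Probability.Probability"
begin

definition (in metric_space) geodesic :: "real \<Rightarrow> (real \<Rightarrow> 'a) \<Rightarrow> bool" where
  "geodesic l \<gamma> \<longleftrightarrow>
     0 \<le> l \<and> (\<forall>s\<in>{0..l}. \<forall>t\<in>{0..l}. dist (\<gamma> s) (\<gamma> t) = \<bar>s - t\<bar>)"

class hadamard_space = complete_space +
  assumes geodesic_exists: "\<exists>l \<gamma>. geodesic l \<gamma> \<and> \<gamma> 0 = x \<and> \<gamma> l = y"
  assumes geodesic_CAT0:
    "geodesic l \<gamma> \<Longrightarrow> 0 \<le> t \<Longrightarrow> t \<le> 1 \<Longrightarrow>
       (dist (\<gamma> (t * l)) x)\<^sup>2 \<le>
         (1 - t) * (dist (\<gamma> 0) x)\<^sup>2 + t * (dist (\<gamma> l) x)\<^sup>2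
         - t * (1 - t) * (dist (\<gamma> 0) (\<gamma> l))\<^sup>2"

text \<open>\<open>geo_comb t x y\<close> is the point \<open>(1 - t) x \<oplus> t y\<close>; it is well defined for
  \<open>0 \<le> t \<le> 1\<close> by \<open>geo_comb_eq\<close> below.\<close>

definition geo_comb :: "real \<Rightarrow> 'h \<Rightarrow> 'h \<Rightarrow> 'h::metric_space" where
  "geo_comb t x y =
     (THE z. \<exists>l \<gamma>. geodesic l \<gamma> \<and> \<gamma> 0 = x \<and> \<gamma> l = y \<and> z = \<gamma> (t * l))"

lemma geodesic_unique:
  fixes \<gamma> \<gamma>' :: "real \<Rightarrow> 'h::hadamard_space"
  assumes g: "geodesic l \<gamma>" "geodesic l' \<gamma>'" and ends: "\<gamma> 0 = \<gamma>' 0" "\<gamma> l = \<gamma>' l'"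
    and t: "0 \<le> t" "t \<le> 1"
  shows "\<gamma> (t * l) = \<gamma>' (t * l')"
proof -
  have l: "0 \<le> l" "0 \<le> l'" using g by (auto simp: geodesic_def)
  have "dist (\<gamma> 0) (\<gamma> l) = l" "dist (\<gamma>' 0) (\<gamma>' l') = l'"
    using g l by (auto simp: geodesic_def)
  then have eq: "l' = l" using ends by simp
  have tl: "t * l \<in> {0..l}" using t l by (auto simp: mult_left_le_one_le)
  have d0: "dist (\<gamma> 0) (\<gamma>' (t * l)) = t * l"
    using g(2) tl l t unfolding ends(1) eq geodesic_def by auto
  have d1: "dist (\<gamma> l) (\<gamma>' (t * l)) = (1 - t) * l"
    using g(2) tl l t unfolding ends(2) eq geodesic_def by (auto simp: algebra_simps)
  have "(dist (\<gamma> (t * l)) (\<gamma>' (t * l)))\<^sup>2 \<le>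
      (1 - t) * (t * l)\<^sup>2 + t * ((1 - t) * l)\<^sup>2 - t * (1 - t) * l\<^sup>2"
    using geodesic_CAT0[OF g(1) t, of "\<gamma>' (t * l)"] d0 d1 \<open>dist (\<gamma> 0) (\<gamma> l) = l\<close> by simp
  also have "\<dots> = 0" by (simp add: power2_eq_square algebra_simps)
  finally show ?thesis using eq by simp
qed

lemma geo_comb_eq:
  fixes \<gamma> :: "real \<Rightarrow> 'h::hadamard_space"
  assumes "geodesic l \<gamma>" "0 \<le> t" "t \<le> 1"
  shows "geo_comb t (\<gamma> 0) (\<gamma> l) = \<gamma> (t * l)"
  unfolding geo_comb_def
proof (rule the_equality)
  show "\<exists>l' \<gamma>'. geodesic l' \<gamma>' \<and> \<gamma>' 0 = \<gamma> 0 \<and> \<gamma>' l' = \<gamma> l \<and> \<gamma> (t * l) = \<gamma>' (t * l')"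
    using assms(1) by blast
next
  fix z assume "\<exists>l' \<gamma>'. geodesic l' \<gamma>' \<and> \<gamma>' 0 = \<gamma> 0 \<and> \<gamma>' l' = \<gamma> l \<and> z = \<gamma>' (t * l')"
  then obtain l' \<gamma>' where "geodesic l' \<gamma>'" "\<gamma>' 0 = \<gamma> 0" "\<gamma>' l' = \<gamma> l" "z = \<gamma>' (t * l')"
    by blast
  then show "z = \<gamma> (t * l)" using geodesic_unique[of l' \<gamma>' l \<gamma> t] assms by simp
qed

text \<open>Sequences are indexed from 1, so index 0 carries no information.\<close>

fun inductive_mean :: "(nat \<Rightarrow> 'h) \<Rightarrow> nat \<Rightarrow> 'h::metric_space" where
  "inductive_mean x 0 = undefined"
| "inductive_mean x (Suc 0) = x 1"
| "inductive_mean x (Suc (Suc n)) =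
     geo_comb (1 / real (Suc (Suc n))) (inductive_mean x (Suc n)) (x (Suc (Suc n)))"

definition L1_variable :: "'w measure \<Rightarrow> ('w \<Rightarrow> 'h::metric_space) \<Rightarrow> bool" where
  "L1_variable M X \<longleftrightarrow> X \<in> borel_measurable M \<and> (\<exists>z. integrable M (\<lambda>\<omega>. dist (X \<omega>) z))"

text \<open>The quantifier over \<open>y\<close> expresses that the minimiser does not depend on the reference point.
  Subtracting \<open>(dist y (X \<omega>))\<^sup>2\<close> makes the integrand integrable when \<open>X\<close> is only in \<open>L\<^sup>1\<close>.\<close>

definition barycenter :: "'w measure \<Rightarrow> ('w \<Rightarrow> 'h) \<Rightarrow> 'h::metric_space" where
  "barycenter M X =
     (THE b. \<forall>y. is_arg_min (\<lambda>z. \<integral>\<omega>. ((dist z (X \<omega>))\<^sup>2 - (dist y (X \<omega>))\<^sup>2) \<partial>M) (\<lambda>_. True) b)"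

definition tail_expectation :: "'w measure \<Rightarrow> 'h \<Rightarrow> ('w \<Rightarrow> 'h::metric_space) \<Rightarrow> real \<Rightarrow> real" where
  "tail_expectation M p X x =
     (\<integral>\<omega>. dist p (X \<omega>) * indicator {\<omega>. dist p (X \<omega>) \<ge> x} \<omega> \<partial>M)"

end

theory Submission
  imports Defs "HOL-Combinatorics.Permutations" "HOL-Library.Discrete_Functions"
begin

text \<open>Truncate: with \<open>R = m powr (1/8)\<close>, let \<open>Y i\<close> be \<open>X i\<close> if \<open>dist p (X i) < R\<close> and \<open>p\<close> otherwise. Inductive means
  are 1-Lipschitz for the averaged distance, so the error \<open>dist (s\<^sub>n X) (s\<^sub>n Y)\<close> is at most the average
  of the i.i.d. tails \<open>dist (X i) (Y i)\<close>, whose supremum is controlled by the maximal ergodic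
  inequality; the error between the barycenters is at most the tail expectation. For the bounded
  variables \<open>Y i\<close>, the variance inequality gives \<open>E (dist (s\<^sub>n Y) b)\<^sup>2 \<le> R\<^sup>2 / n\<close>; Chebyshev's inequality is
  summed over the squares \<open>n = k\<^sup>2\<close>, and between two squares \<open>s\<^sub>n\<close> moves by at most \<open>4 R / k\<close>. Only
  the case that the right-hand side is below 1 matters, and it forces \<open>m\<close> to be large.\<close>

section \<open>Geodesic combinations and their contraction properties\<close>

lemma
  fixes x y :: "'h::hadamard_space"
  assumes "0 \<le> t" "t \<le> 1"
  shows geo_comb_dist_left: "dist x (geo_comb t x y) = t * dist x y"
    and geo_comb_dist_right: "dist y (geo_comb t x y) = (1 - t) * dist x y"
    and geo_comb_CAT0: "(dist (geo_comb t x y) z)\<^sup>2 \<le>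
         (1 - t) * (dist x z)\<^sup>2 + t * (dist y z)\<^sup>2 - t * (1 - t) * (dist x y)\<^sup>2"
proof -
  obtain l \<gamma> where g: "geodesic l \<gamma>" "\<gamma> 0 = x" "\<gamma> l = y"
    using geodesic_exists[of x y] by blast
  have eq: "geo_comb t x y = \<gamma> (t * l)"
    using geo_comb_eq[OF g(1) assms] g by simp
  have l: "0 \<le> l" using g(1) by (simp add: geodesic_def)
  have tl: "t * l \<in> {0..l}" using assms l by (auto simp: mult_left_le_one_le)
  have d: "dist (\<gamma> r) (\<gamma> s) = \<bar>r - s\<bar>" if "r \<in> {0..l}" "s \<in> {0..l}" for r s
    using g(1) that unfolding geodesic_def by blast
  have xy: "dist x y = l" using d[of 0 l] l g by simp
  show "dist x (geo_comb t x y) = t * dist x y"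
    using d[of 0 "t * l"] tl l g eq xy by simp
  show "dist y (geo_comb t x y) = (1 - t) * dist x y"
    using d[of l "t * l"] tl l g eq xy by (simp add: algebra_simps)
  show "(dist (geo_comb t x y) z)\<^sup>2 \<le>
         (1 - t) * (dist x z)\<^sup>2 + t * (dist y z)\<^sup>2 - t * (1 - t) * (dist x y)\<^sup>2"
    using geodesic_CAT0[OF g(1) assms, of z] g eq by simp
qed

text \<open>Two uses of CAT0: for the pair \<open>x\<close>, \<open>y\<close> seen from
  \<open>?q\<close>, then for the pair \<open>x\<close>, \<open>y'\<close> seen from
  \<open>y\<close>. Distances from \<open>x\<close> are known exactly along a geodesic, so all other
  terms cancel and a perfect square remains.\<close>

lemma geo_comb_contract_right:
  fixes x y y' :: "'h::hadamard_space"
  assumes t: "0 \<le> t" "t \<le> 1"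
  shows "dist (geo_comb t x y) (geo_comb t x y') \<le> t * dist y y'"
proof (rule power2_le_imp_le)
  let ?q = "geo_comb t x y'"
  have "(dist (geo_comb t x y) ?q)\<^sup>2 \<le>
      (1 - t) * (dist x ?q)\<^sup>2 + t * (dist ?q y)\<^sup>2 - t * (1 - t) * (dist x y)\<^sup>2"
    using geo_comb_CAT0[OF t, of x y ?q] by (simp add: dist_commute)
  also have "\<dots> \<le> (1 - t) * (t * dist x y')\<^sup>2
      + t * ((1 - t) * (dist x y)\<^sup>2 + t * (dist y y')\<^sup>2 - t * (1 - t) * (dist x y')\<^sup>2)
      - t * (1 - t) * (dist x y)\<^sup>2"
    unfolding geo_comb_dist_left[OF t]
    using mult_left_mono[OF geo_comb_CAT0[OF t, of x y' y] t(1)] by (simp add: dist_commute)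
  also have "\<dots> = (t * dist y y')\<^sup>2"
    by (simp add: power2_eq_square algebra_simps)
  finally show "(dist (geo_comb t x y) ?q)\<^sup>2 \<le> (t * dist y y')\<^sup>2" .
qed (use t in simp)

text \<open>The mirror image of \<open>geo_comb_contract_right\<close>: here the exact distances are
  those from the common endpoint \<open>y\<close>.\<close>

lemma geo_comb_contract_left:
  fixes x x' y :: "'h::hadamard_space"
  assumes t: "0 \<le> t" "t \<le> 1"
  shows "dist (geo_comb t x y) (geo_comb t x' y) \<le> (1 - t) * dist x x'"
proof (rule power2_le_imp_le)
  let ?q = "geo_comb t x' y"
  have "(dist (geo_comb t x y) ?q)\<^sup>2 \<le>
      (1 - t) * (dist ?q x)\<^sup>2 + t * (dist y ?q)\<^sup>2 - t * (1 - t) * (dist x y)\<^sup>2"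
    using geo_comb_CAT0[OF t, of x y ?q] by (simp add: dist_commute)
  also have "\<dots> \<le> (1 - t) * ((1 - t) * (dist x' x)\<^sup>2 + t * (dist y x)\<^sup>2 - t * (1 - t) * (dist x' y)\<^sup>2)
      + t * ((1 - t) * dist x' y)\<^sup>2 - t * (1 - t) * (dist x y)\<^sup>2"
    unfolding geo_comb_dist_right[OF t]
    using mult_left_mono[OF geo_comb_CAT0[OF t, of x' y x], of "1 - t"] t by simp
  also have "\<dots> = ((1 - t) * dist x x')\<^sup>2"
    by (simp add: power2_eq_square algebra_simps dist_commute)
  finally show "(dist (geo_comb t x y) ?q)\<^sup>2 \<le> ((1 - t) * dist x x')\<^sup>2" .
qed (use t in simp)

lemma geo_comb_contract:
  fixes x x' y y' :: "'h::hadamard_space"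
  assumes t: "0 \<le> t" "t \<le> 1"
  shows "dist (geo_comb t x y) (geo_comb t x' y') \<le> (1 - t) * dist x x' + t * dist y y'"
  using geo_comb_contract_left[OF t, of x y x'] geo_comb_contract_right[OF t, of x' y y']
    dist_triangle[of "geo_comb t x y" "geo_comb t x' y'" "geo_comb t x' y"] by linarith

lemma geo_comb_self:
  fixes x :: "'h::hadamard_space"
  assumes "0 \<le> t" "t \<le> 1"
  shows "geo_comb t x x = x"
  using geo_comb_dist_left[OF assms, of x x] by simp

lemma geo_comb_convex_dist:
  fixes x y z :: "'h::hadamard_space"
  assumes "0 \<le> t" "t \<le> 1"
  shows "dist (geo_comb t x y) z \<le> (1 - t) * dist x z + t * dist y z"
  using geo_comb_contract[OF assms, of x y z z] geo_comb_self[OF assms, of z] by simp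

text \<open>By contraction in both arguments the map is 1-Lipschitz for the product metric, so
  \<open>e\<close> itself serves as the radius.\<close>

lemma continuous_on_geo_comb:
  assumes t: "0 \<le> t" "t \<le> 1"
  shows "continuous_on UNIV (\<lambda>z::'h::hadamard_space \<times> 'h. geo_comb t (fst z) (snd z))"
proof (rule continuous_onI)
  fix z :: "'h \<times> 'h" and e :: real
  assume e: "e > 0"
  show "\<exists>d>0. \<forall>z'\<in>UNIV. dist z' z < d \<longrightarrow>
      dist (geo_comb t (fst z') (snd z')) (geo_comb t (fst z) (snd z)) \<le> e"
  proof (intro exI[of _ e] conjI ballI impI e)
    fix z' assume d: "dist z' z < e"
    have "(1 - t) * dist (fst z') (fst z) + t * dist (snd z') (snd z)
        \<le> (1 - t) * dist z' z + t * dist z' z"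
      using t by (intro add_mono mult_left_mono dist_fst_le dist_snd_le) auto
    also have "\<dots> = dist z' z" by (simp add: algebra_simps)
    finally show "dist (geo_comb t (fst z') (snd z')) (geo_comb t (fst z) (snd z)) \<le> e"
      using geo_comb_contract[OF t, of "fst z'" "snd z'" "fst z" "snd z"] d by linarith
  qed
qed

text \<open>Second countability, the form in which separability is assumed, makes the pair of
  \<open>f\<close> and \<open>g\<close> Borel measurable, and a continuous map is applied to
  it.\<close>

lemma measurable_geo_comb [measurable (raw)]:
  fixes f g :: "'w \<Rightarrow> 'h::{hadamard_space, second_countable_topology}"
  assumes "0 \<le> t" "t \<le> 1" "f \<in> borel_measurable M" "g \<in> borel_measurable M"
  shows "(\<lambda>\<omega>. geo_comb t (f \<omega>) (g \<omega>)) \<in> borel_measurable M"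
  by (rule borel_measurable_continuous_Pair[OF assms(3,4) continuous_on_geo_comb[OF assms(1,2)]])

text \<open>Split the diagonal from \<open>a\<close> to \<open>y\<close> in the ratio of the two opposite sides \<open>d(a,b)\<close>
  and \<open>d(x,y)\<close>.\<close>

lemma quadrilateral_inequality:
  fixes a b x y :: "'h::hadamard_space"
  shows "(dist a y)\<^sup>2 + (dist b x)\<^sup>2 \<le> (dist a x)\<^sup>2 + (dist b y)\<^sup>2 + 2 * dist a b * dist x y"
proof (cases "a = b \<or> x = y")
  case False
  define u v where "u = dist a b" and "v = dist x y"
  have uv: "u > 0" "v > 0" using False by (auto simp: u_def v_def)
  define t where "t = u / (u + v)"
  have t: "0 \<le> t" "t \<le> 1" using uv by (auto simp: t_def)
  have t': "1 - t = v / (u + v)" using uv by (simp add: t_def field_simps)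
  define w where "w = geo_comb t a y"
  have wb: "(dist w b)\<^sup>2 \<le> (1 - t) * u\<^sup>2 + t * (dist b y)\<^sup>2 - t * (1 - t) * (dist a y)\<^sup>2"
    using geo_comb_CAT0[OF t, of a y b] by (simp add: w_def u_def dist_commute)
  have wx: "(dist w x)\<^sup>2 \<le> (1 - t) * (dist a x)\<^sup>2 + t * v\<^sup>2 - t * (1 - t) * (dist a y)\<^sup>2"
    using geo_comb_CAT0[OF t, of a y x] by (simp add: w_def v_def dist_commute)
  have "dist b x \<le> dist w b + dist w x"
    by (metis dist_commute dist_triangle)
  then have "(dist b x)\<^sup>2 \<le> (dist w b + dist w x)\<^sup>2"
    by (intro power_mono) auto
  then have "u * v * (dist b x)\<^sup>2 \<le> u * v * (dist w b + dist w x)\<^sup>2"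
    using uv by simp
  also have "\<dots> \<le> (u + v) * (v * (dist w b)\<^sup>2 + u * (dist w x)\<^sup>2)"
  proof -
    \<comment> \<open>A weighted Cauchy-Schwarz inequality whose deficit is a perfect square. It
      replaces the path from \<open>b\<close> to \<open>x\<close> through \<open>w\<close> by the
      two squared distances that CAT0 controls.\<close>
    have "(u + v) * (v * p\<^sup>2 + u * q\<^sup>2) - u * v * (p + q)\<^sup>2 = (v * p - u * q)\<^sup>2" for p q
      by (simp add: power2_eq_square algebra_simps)
    then show ?thesis by (metis diff_ge_0_iff_ge zero_le_power2)
  qed
  also have "\<dots> \<le> (u + v) * (v * ((1 - t) * u\<^sup>2 + t * (dist b y)\<^sup>2 - t * (1 - t) * (dist a y)\<^sup>2)
       + u * ((1 - t) * (dist a x)\<^sup>2 + t * v\<^sup>2 - t * (1 - t) * (dist a y)\<^sup>2))"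
    using uv by (intro mult_left_mono add_mono wb wx) auto
  also have "\<dots> = u * v * ((dist a x)\<^sup>2 + (dist b y)\<^sup>2 + 2 * u * v - (dist a y)\<^sup>2)"
  proof -
    \<comment> \<open>Each factor \<open>u + v\<close> is paired with one \<open>t\<close> or
      \<open>1 - t\<close>, which removes all denominators.\<close>
    have T: "(u + v) * t = u" "(u + v) * (1 - t) = v"
      using uv unfolding t' unfolding t_def by auto
    have eq: "(u + v) * (v * ((1 - t) * A + t * B - t * (1 - t) * C)
        + u * ((1 - t) * D + t * E - t * (1 - t) * C))
      = v * (((u + v) * (1 - t)) * A + ((u + v) * t) * B) + u * (((u + v) * (1 - t)) * D + ((u + v) * t) * E)
        - ((u + v) * t) * ((u + v) * (1 - t)) * C" for A B C D E
      by (simp add: algebra_simps)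
    show ?thesis unfolding eq T by (simp add: power2_eq_square algebra_simps)
  qed
  finally show ?thesis
    using uv by (simp add: u_def v_def)
qed (auto simp: dist_commute)

section \<open>Barycenters of integrable variables and the variance inequality\<close>

lemma (in prob_space) L1_variable_integrable:
  assumes "L1_variable M (X :: 'a \<Rightarrow> 'h::{metric_space, second_countable_topology})"
  shows "integrable M (\<lambda>\<omega>. dist z (X \<omega>))"
proof -
  have [measurable]: "X \<in> borel_measurable M" using assms by (simp add: L1_variable_def)
  obtain z0 where z0: "integrable M (\<lambda>\<omega>. dist (X \<omega>) z0)"
    using assms by (auto simp: L1_variable_def)
  show ?thesis
  proof (rule Bochner_Integration.integrable_bound)
    show "integrable M (\<lambda>\<omega>. dist z z0 + dist (X \<omega>) z0)" using z0 by auto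
    have "dist z (X \<omega>) \<le> dist z z0 + dist (X \<omega>) z0" for \<omega>
      by (metis dist_commute dist_triangle)
    then show "AE \<omega> in M. norm (dist z (X \<omega>)) \<le> norm (dist z z0 + dist (X \<omega>) z0)"
      by auto
  qed measurable
qed

text \<open>Factoring the difference of squares leaves one factor bounded by the constant
  \<open>dist z y\<close>, so a first moment suffices.\<close>

lemma (in prob_space) L1_variable_integrable_sq_diff:
  assumes "L1_variable M (X :: 'a \<Rightarrow> 'h::{metric_space, second_countable_topology})"
  shows "integrable M (\<lambda>\<omega>. (dist z (X \<omega>))\<^sup>2 - (dist y (X \<omega>))\<^sup>2)"
proof -
  have [measurable]: "X \<in> borel_measurable M" using assms by (simp add: L1_variable_def)
  show ?thesis
  proof (rule Bochner_Integration.integrable_bound)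
    show "integrable M (\<lambda>\<omega>. dist z y * (dist z (X \<omega>) + dist y (X \<omega>)))"
      using L1_variable_integrable[OF assms] by auto
    have "\<bar>(dist z (X \<omega>))\<^sup>2 - (dist y (X \<omega>))\<^sup>2\<bar> \<le> dist z y * (dist z (X \<omega>) + dist y (X \<omega>))" for \<omega>
    proof -
      have "\<bar>dist z (X \<omega>) - dist y (X \<omega>)\<bar> \<le> dist z y"
        by (metis abs_dist_diff_le dist_commute)
      then show ?thesis
        unfolding power2_eq_square square_diff_square_factored abs_mult
        by (subst mult.commute) (auto intro!: mult_mono)
    qed
    then show "AE \<omega> in M. norm ((dist z (X \<omega>))\<^sup>2 - (dist y (X \<omega>))\<^sup>2)
        \<le> norm (dist z y * (dist z (X \<omega>) + dist y (X \<omega>)))"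
      by (auto intro: order_trans)
  qed measurable
qed


text \<open>The integrated CAT0 inequality makes the functional uniformly convex. Hence minimising
  sequences are Cauchy, their limit is a minimiser by completeness, and two minimisers
  coincide.\<close>

lemma (in prob_space) ex1_barycenter:
  fixes X :: "'a \<Rightarrow> 'h::{hadamard_space, second_countable_topology}"
  assumes L1: "L1_variable M X"
  shows "\<exists>!b. \<forall>y. is_arg_min (\<lambda>z. \<integral>\<omega>. ((dist z (X \<omega>))\<^sup>2 - (dist y (X \<omega>))\<^sup>2) \<partial>M) (\<lambda>_. True) b"
proof -
  note int1 = L1_variable_integrable[OF L1]
  note int2 = L1_variable_integrable_sq_diff[OF L1]
  define F where "F y z = (\<integral>\<omega>. ((dist z (X \<omega>))\<^sup>2 - (dist y (X \<omega>))\<^sup>2) \<partial>M)" for y z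
  have F_diff: "F y z - F y w = F w z" for y z w
    unfolding F_def by (subst Bochner_Integration.integral_diff[symmetric]) (auto intro: int2)
  \<comment> \<open>One reference point is enough: by \<open>F_diff\<close>, another choice shifts
    the functional by a constant and keeps its minimisers.\<close>
  fix y0 :: 'h
  \<comment> \<open>The reverse triangle inequality bounds the functional below by a quadratic in
    \<open>?D\<close>; completing the square gives a bound free of \<open>z\<close>.\<close>
  have below: "- (expectation (\<lambda>\<omega>. dist y0 (X \<omega>)))\<^sup>2 \<le> F y0 z" for z
  proof -
    let ?D = "dist z y0" and ?E = "expectation (\<lambda>\<omega>. dist y0 (X \<omega>))"
    have "?D\<^sup>2 - 2 * ?D * ?E = expectation (\<lambda>\<omega>. ?D\<^sup>2 - 2 * ?D * dist y0 (X \<omega>))"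
      using int1 by (simp add: prob_space)
    also have "\<dots> \<le> F y0 z"
      unfolding F_def
    proof (intro integral_mono int2)
      fix \<omega>
      have "\<bar>?D - dist y0 (X \<omega>)\<bar> \<le> dist z (X \<omega>)"
        using abs_dist_diff_le[of z y0 "X \<omega>"] by (simp add: dist_commute)
      from power_mono[OF this, of 2]
      show "?D\<^sup>2 - 2 * ?D * dist y0 (X \<omega>) \<le> (dist z (X \<omega>))\<^sup>2 - (dist y0 (X \<omega>))\<^sup>2"
        by (simp add: power2_diff)
    qed (use int1 in auto)
    finally show ?thesis
      using zero_le_power2[of "?D - ?E"] by (simp add: power2_diff)
  qed
  \<comment> \<open>A one-sided continuity estimate. Its constant involves only the first point
    \<open>z\<close>, which will be the fixed limit, while \<open>w\<close> runs through the
    sequence.\<close>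
  have upper: "F w z \<le> 2 * dist z w * expectation (\<lambda>\<omega>. dist z (X \<omega>))" for z w
  proof -
    have "F w z \<le> expectation (\<lambda>\<omega>. 2 * dist z w * dist z (X \<omega>))"
      unfolding F_def
    proof (intro integral_mono int2)
      fix \<omega>
      have "\<bar>dist z (X \<omega>) - dist z w\<bar> \<le> dist w (X \<omega>)"
        using abs_dist_diff_le[of "X \<omega>" z w] by (simp add: dist_commute)
      from power_mono[OF this, of 2]
      show "(dist z (X \<omega>))\<^sup>2 - (dist w (X \<omega>))\<^sup>2 \<le> 2 * dist z w * dist z (X \<omega>)"
        using zero_le_power2[of "dist z w"] unfolding power2_abs power2_diff
        by (simp only: mult_ac) linarith
    qed (use int1 in auto)
    then show ?thesis by simp
  qed
  have convex: "F y0 (geo_comb (1/2) z w) \<le> F y0 z / 2 + F y0 w / 2 - (dist z w)\<^sup>2 / 4" for z w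
  proof -
    have "F y0 (geo_comb (1/2) z w) \<le> expectation (\<lambda>\<omega>. ((dist z (X \<omega>))\<^sup>2 - (dist y0 (X \<omega>))\<^sup>2) / 2
        + ((dist w (X \<omega>))\<^sup>2 - (dist y0 (X \<omega>))\<^sup>2) / 2 - (dist z w)\<^sup>2 / 4)"
      unfolding F_def
    proof (intro integral_mono int2)
      fix \<omega>
      show "(dist (geo_comb (1/2) z w) (X \<omega>))\<^sup>2 - (dist y0 (X \<omega>))\<^sup>2
        \<le> ((dist z (X \<omega>))\<^sup>2 - (dist y0 (X \<omega>))\<^sup>2) / 2
        + ((dist w (X \<omega>))\<^sup>2 - (dist y0 (X \<omega>))\<^sup>2) / 2 - (dist z w)\<^sup>2 / 4"
        using geo_comb_CAT0[of "1/2" z w "X \<omega>"] by (simp add: field_simps)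
    qed (use int2 in auto)
    also have "\<dots> = F y0 z / 2 + F y0 w / 2 - (dist z w)\<^sup>2 / 4"
      unfolding F_def using int2 by (simp add: prob_space)
    finally show ?thesis .
  qed
  define I where "I = (INF z. F y0 z)"
  have bdd: "bdd_below (range (F y0))" using below by (auto intro!: bdd_belowI)
  have I_le: "I \<le> F y0 z" for z unfolding I_def using bdd by (auto intro: cINF_lower)
  \<comment> \<open>The midpoint of \<open>z\<close> and \<open>w\<close> cannot have a value below
    the infimum, so \<open>convex\<close> bounds their distance by how far both are from
    optimal.\<close>
  have close: "(dist z w)\<^sup>2 \<le> 2 * (F y0 z - I) + 2 * (F y0 w - I)" for z w
    using convex[of z w] I_le[of "geo_comb (1/2) z w"] by (simp add: field_simps)
  have "\<exists>z. F y0 z < I + 1 / real (Suc n)" for n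
    using cINF_less_iff[of UNIV "F y0" "I + 1 / real (Suc n)"] bdd by (auto simp: I_def)
  then obtain z where z: "\<And>n. F y0 (z n) < I + 1 / real (Suc n)" by metis
  have "Cauchy z"
  proof (rule metric_CauchyI)
    fix e :: real assume e: "e > 0"
    \<comment> \<open>Beyond \<open>N\<close> the values exceed the infimum by less than
      \<open>e\<^sup>2 / 4\<close>, and \<open>close\<close> adds up four such amounts.\<close>
    obtain N where N: "4 / e\<^sup>2 < real N" using reals_Archimedean2 by blast
    show "\<exists>N. \<forall>m\<ge>N. \<forall>n\<ge>N. dist (z m) (z n) < e"
    proof (intro exI[of _ N] allI impI)
      fix m n assume mn: "m \<ge> N" "n \<ge> N"
      have "F y0 (z k) - I < e\<^sup>2 / 4" if "k \<ge> N" for k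
      proof -
        have "4 / e\<^sup>2 < real (Suc k)" using N that by simp
        then have "1 / real (Suc k) < e\<^sup>2 / 4" using e by (simp add: field_simps)
        then show ?thesis using z[of k] by simp
      qed
      from this[OF mn(1)] this[OF mn(2)] have "(dist (z m) (z n))\<^sup>2 < e\<^sup>2"
        using close[of "z m" "z n"] by simp
      then show "dist (z m) (z n) < e" using e by (simp add: power2_less_imp_less)
    qed
  qed
  then obtain b where b: "z \<longlonglongrightarrow> b" using Cauchy_convergent convergent_def by blast
  have "F y0 b \<le> I"
  proof (rule LIMSEQ_le_const)
    have "(\<lambda>n. dist b (z n)) \<longlonglongrightarrow> dist b b" by (intro tendsto_intros b)
    moreover have "(\<lambda>n. 1 / real (Suc n)) \<longlonglongrightarrow> 0" by (rule LIMSEQ_Suc[OF lim_1_over_n])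
    ultimately have "(\<lambda>n. I + 1 / real (Suc n) + 2 * dist b (z n) * expectation (\<lambda>\<omega>. dist b (X \<omega>)))
       \<longlonglongrightarrow> I + 0 + 2 * dist b b * expectation (\<lambda>\<omega>. dist b (X \<omega>))"
      by (intro tendsto_intros b)
    then show "(\<lambda>n. I + 1 / real (Suc n) + 2 * dist b (z n) * expectation (\<lambda>\<omega>. dist b (X \<omega>))) \<longlonglongrightarrow> I"
      by simp
    have "F y0 b \<le> I + 1 / real (Suc n) + 2 * dist b (z n) * expectation (\<lambda>\<omega>. dist b (X \<omega>))" for n
      using upper[of "z n" b] F_diff[of y0 b "z n"] z[of n] by simp
    then show "\<exists>N. \<forall>n\<ge>N. F y0 b \<le> I + 1 / real (Suc n) + 2 * dist b (z n) * expectation (\<lambda>\<omega>. dist b (X \<omega>))"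
      by blast
  qed
  then have min: "F y0 b \<le> F y0 w" for w using I_le order_trans by blast
  have min': "F y b \<le> F y w" for y w
    using min[of w] F_diff[of y b w] F_diff[of y0 b w] by simp
  have uniq: "c = b" if "\<And>w. F y0 c \<le> F y0 w" for c
  proof -
    have "F y0 c = I" "F y0 b = I"
      using \<open>F y0 b \<le> I\<close> that[of b] I_le[of c] I_le[of b] by auto
    then show ?thesis using close[of c b] by simp
  qed
  have "\<exists>!b. \<forall>y. is_arg_min (F y) (\<lambda>_. True) b"
    using min' uniq by (auto simp: is_arg_min_linorder intro!: ex1I[of _ b])
  then show ?thesis by (simp add: F_def[abs_def])
qed

lemma (in prob_space) barycenter_minimises:
  fixes X :: "'a \<Rightarrow> 'h::{hadamard_space, second_countable_topology}"
  assumes L1: "L1_variable M X"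
  shows "0 \<le> (\<integral>\<omega>. ((dist z (X \<omega>))\<^sup>2 - (dist (barycenter M X) (X \<omega>))\<^sup>2) \<partial>M)"
proof -
  have "\<forall>y. is_arg_min (\<lambda>z. \<integral>\<omega>. ((dist z (X \<omega>))\<^sup>2 - (dist y (X \<omega>))\<^sup>2) \<partial>M) (\<lambda>_. True) (barycenter M X)"
    unfolding barycenter_def by (rule theI'[OF ex1_barycenter[OF L1]])
  from spec[OF this, of "barycenter M X"] show ?thesis
    by (auto simp: is_arg_min_linorder dest!: spec[of _ z])
qed

text \<open>A first-order argument at the minimum: compare the barycenter with the point at
  parameter \<open>t\<close> on the geodesic to \<open>z\<close>, apply CAT0, divide by
  \<open>t\<close> and let \<open>t\<close> tend to 0.\<close>

lemma (in prob_space) variance_inequality: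
  fixes X :: "'a \<Rightarrow> 'h::{hadamard_space, second_countable_topology}"
  assumes L1: "L1_variable M X"
  shows "(dist z (barycenter M X))\<^sup>2 \<le>
    (\<integral>\<omega>. ((dist z (X \<omega>))\<^sup>2 - (dist (barycenter M X) (X \<omega>))\<^sup>2) \<partial>M)" (is "?D \<le> ?V")
proof -
  note int2 = L1_variable_integrable_sq_diff[OF L1]
  define b where "b = barycenter M X"
  have le: "(1 - t) * ?D \<le> ?V" if t: "0 < t" "t < 1" for t
  proof -
    have "0 \<le> (\<integral>\<omega>. ((dist (geo_comb t b z) (X \<omega>))\<^sup>2 - (dist b (X \<omega>))\<^sup>2) \<partial>M)"
      unfolding b_def by (rule barycenter_minimises[OF L1])
    also have "\<dots> \<le> (\<integral>\<omega>. (t * ((dist z (X \<omega>))\<^sup>2 - (dist b (X \<omega>))\<^sup>2) - t * (1 - t) * ?D) \<partial>M)"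
    proof (intro integral_mono int2)
      fix \<omega>
      show "(dist (geo_comb t b z) (X \<omega>))\<^sup>2 - (dist b (X \<omega>))\<^sup>2
         \<le> t * ((dist z (X \<omega>))\<^sup>2 - (dist b (X \<omega>))\<^sup>2) - t * (1 - t) * ?D"
        using geo_comb_CAT0[of t b z "X \<omega>"] t
        by (simp add: algebra_simps dist_commute b_def)
    qed (use int2 in auto)
    also have "\<dots> = t * ?V - t * (1 - t) * ?D"
      unfolding b_def[symmetric]
      by (subst Bochner_Integration.integral_diff) (auto simp: prob_space intro!: int2)
    also have "\<dots> = t * (?V - (1 - t) * ?D)" by (simp add: algebra_simps)
    finally show ?thesis using t by (simp add: zero_le_mult_iff)
  qed
  have "((\<lambda>t. (1 - t) * ?D) \<longlongrightarrow> (1 - 0) * ?D) (at_right (0::real))"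
    by (intro tendsto_intros)
  moreover have "\<forall>\<^sub>F t in at_right (0::real). (1 - t) * ?D \<le> ?V"
    using eventually_at_right_less[of 0] eventually_at_right_real[of 0 1]
    by (auto elim!: eventually_mono intro: le)
  ultimately show ?thesis
    by (intro tendsto_upperbound[where F="at_right (0::real)"]) auto
qed

text \<open>The variance inequality for \<open>X\<close> at \<open>b\<close> plus the one for
  \<open>Y\<close> at \<open>a\<close> gives \<open>2 * (dist a b)\<^sup>2\<close> on the left. The
  quadrilateral inequality bounds the combined integrand by a multiple of \<open>dist a b\<close>,
  which is then cancelled.\<close>

lemma (in prob_space) dist_barycenter_le:
  fixes X Y :: "'a \<Rightarrow> 'h::{hadamard_space, second_countable_topology}"
  assumes X: "L1_variable M X" and Y: "L1_variable M Y"
  shows "dist (barycenter M X) (barycenter M Y) \<le> expectation (\<lambda>\<omega>. dist (X \<omega>) (Y \<omega>))"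
proof -
  define a b where "a = barycenter M X" and "b = barycenter M Y"
  have [measurable]: "X \<in> borel_measurable M" "Y \<in> borel_measurable M"
    using X Y by (auto simp: L1_variable_def)
  note intX = L1_variable_integrable_sq_diff[OF X] and intY = L1_variable_integrable_sq_diff[OF Y]
  have int: "integrable M (\<lambda>\<omega>. dist (X \<omega>) (Y \<omega>))"
  proof (rule Bochner_Integration.integrable_bound)
    show "integrable M (\<lambda>\<omega>. dist a (X \<omega>) + dist a (Y \<omega>))"
      by (intro Bochner_Integration.integrable_add L1_variable_integrable X Y)
    have "dist (X \<omega>) (Y \<omega>) \<le> dist a (X \<omega>) + dist a (Y \<omega>)" for \<omega>
      by (metis dist_commute dist_triangle)
    then show "AE \<omega> in M. norm (dist (X \<omega>) (Y \<omega>)) \<le> norm (dist a (X \<omega>) + dist a (Y \<omega>))"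
      by auto
  qed measurable
  have "2 * (dist a b)\<^sup>2 \<le> (\<integral>\<omega>. ((dist b (X \<omega>))\<^sup>2 - (dist a (X \<omega>))\<^sup>2) \<partial>M)
      + (\<integral>\<omega>. ((dist a (Y \<omega>))\<^sup>2 - (dist b (Y \<omega>))\<^sup>2) \<partial>M)"
    using variance_inequality[OF X, of b] variance_inequality[OF Y, of a]
    by (simp add: a_def b_def dist_commute)
  also have "\<dots> = (\<integral>\<omega>. ((dist b (X \<omega>))\<^sup>2 - (dist a (X \<omega>))\<^sup>2) + ((dist a (Y \<omega>))\<^sup>2 - (dist b (Y \<omega>))\<^sup>2) \<partial>M)"
    by (intro Bochner_Integration.integral_add[symmetric] intX intY)
  also have "\<dots> \<le> (\<integral>\<omega>. 2 * dist a b * dist (X \<omega>) (Y \<omega>) \<partial>M)"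
  proof (intro integral_mono Bochner_Integration.integrable_add intX intY)
    fix \<omega>
    show "(dist b (X \<omega>))\<^sup>2 - (dist a (X \<omega>))\<^sup>2 + ((dist a (Y \<omega>))\<^sup>2 - (dist b (Y \<omega>))\<^sup>2)
       \<le> 2 * dist a b * dist (X \<omega>) (Y \<omega>)"
      using quadrilateral_inequality[of a "Y \<omega>" b "X \<omega>"] by simp
  qed (use int in auto)
  finally have *: "dist a b * dist a b \<le> dist a b * expectation (\<lambda>\<omega>. dist (X \<omega>) (Y \<omega>))"
    by (simp add: power2_eq_square)
  show ?thesis
  proof (cases "dist a b = 0")
    case True
    then show ?thesis by (simp add: a_def b_def)
  next
    case False
    then show ?thesis using * by (simp add: a_def b_def)
  qed
qed

section \<open>Deterministic estimates for inductive means\<close>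

lemma inductive_mean_Suc:
  "n \<ge> 1 \<Longrightarrow> inductive_mean x (Suc n) = geo_comb (1 / real (Suc n)) (inductive_mean x n) (x (Suc n))"
  by (cases n) auto

lemma inductive_mean_cong:
  "(\<And>i. i \<in> {1..n} \<Longrightarrow> x i = y i) \<Longrightarrow> inductive_mean x n = inductive_mean y n"
proof (induction n)
  case (Suc n)
  then show ?case
    by (cases "n = 0") (auto simp: inductive_mean_Suc)
qed simp

lemma measurable_inductive_mean:
  fixes X :: "nat \<Rightarrow> 'w \<Rightarrow> 'h::{hadamard_space, second_countable_topology}"
  assumes "\<And>i. i \<in> {1..n} \<Longrightarrow> X i \<in> borel_measurable M"
  shows "(\<lambda>\<omega>. inductive_mean (\<lambda>i. X i \<omega>) n) \<in> borel_measurable M"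
  using assms
proof (induction n)
  case (Suc n)
  then show ?case
    by (cases "n = 0") (auto simp: inductive_mean_Suc intro!: measurable_geo_comb)
qed simp

lemma dist_inductive_mean_le:
  fixes x y :: "nat \<Rightarrow> 'h::hadamard_space"
  assumes "n \<ge> 1"
  shows "real n * dist (inductive_mean x n) (inductive_mean y n) \<le> (\<Sum>i=1..n. dist (x i) (y i))"
  using assms
proof (induction n rule: nat_induct_at_least)
  case (Suc n)
  let ?t = "1 / real (Suc n)"
  have "real (Suc n) * dist (inductive_mean x (Suc n)) (inductive_mean y (Suc n))
      \<le> real (Suc n) * ((1 - ?t) * dist (inductive_mean x n) (inductive_mean y n) + ?t * dist (x (Suc n)) (y (Suc n)))"
    unfolding inductive_mean_Suc[OF Suc.hyps]
    by (intro mult_left_mono geo_comb_contract) auto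
  also have "\<dots> = (real (Suc n) * (1 - ?t)) * dist (inductive_mean x n) (inductive_mean y n)
      + (real (Suc n) * ?t) * dist (x (Suc n)) (y (Suc n))"
    by (simp only: distrib_left mult.assoc)
  also have "real (Suc n) * (1 - ?t) = real n" by (simp add: field_simps)
  also have "real (Suc n) * ?t = 1" by simp
  finally show ?case using Suc.IH by simp
qed simp

lemma inductive_mean_in_cball:
  fixes x :: "nat \<Rightarrow> 'h::hadamard_space"
  assumes x: "\<And>i. i \<ge> 1 \<Longrightarrow> dist p (x i) \<le> R" and "n \<ge> 1"
  shows "dist p (inductive_mean x n) \<le> R"
  using assms(2)
proof (induction n rule: nat_induct_at_least)
  case (Suc n)
  let ?t = "1 / real (Suc n)"
  have "dist (inductive_mean x (Suc n)) p \<le> (1 - ?t) * dist (inductive_mean x n) p + ?t * dist (x (Suc n)) p"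
    unfolding inductive_mean_Suc[OF Suc.hyps] by (intro geo_comb_convex_dist) auto
  also have "\<dots> \<le> (1 - ?t) * R + ?t * R"
    using Suc.IH x[of "Suc n"] by (intro add_mono mult_left_mono) (auto simp: dist_commute)
  finally show ?case by (simp add: algebra_simps dist_commute)
qed (use x in simp)

text \<open>The step to index \<open>i\<close> moves a fraction \<open>1 / i\<close> of a distance
  at most \<open>2 * R\<close>, since both the mean and the new point lie in the ball around
  \<open>p\<close>.\<close>

lemma inductive_mean_drift:
  fixes x :: "nat \<Rightarrow> 'h::hadamard_space"
  assumes x: "\<And>i. i \<ge> 1 \<Longrightarrow> dist p (x i) \<le> R" and "k \<ge> 1"
  shows "dist (inductive_mean x k) (inductive_mean x (k + j)) \<le> real j * (2 * R / real k)"
proof (induction j)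
  case (Suc j)
  let ?s = "inductive_mean x (k + j)"
  have R: "0 \<le> R" using x[of 1] zero_le_dist[of p "x 1"] by linarith
  have kj: "k + j \<ge> 1" using assms(2) by simp
  have "dist ?s (x (Suc (k + j))) \<le> 2 * R"
    using dist_triangle[of ?s "x (Suc (k + j))" p] inductive_mean_in_cball[of p x R, OF x kj]
      x[of "Suc (k + j)"] by (simp add: dist_commute)
  then have "dist ?s (inductive_mean x (Suc (k + j))) \<le> 1 / real (Suc (k + j)) * (2 * R)"
    unfolding inductive_mean_Suc[OF kj]
    by (subst geo_comb_dist_left) (auto intro!: divide_right_mono)
  also have "\<dots> \<le> 2 * R / real k"
    using R assms(2) by (simp add: frac_le)
  finally show ?case
    using Suc.IH dist_triangle[of "inductive_mean x k" "inductive_mean x (Suc (k + j))" ?s]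
    by (simp add: algebra_simps add_divide_distrib)
qed simp

section \<open>Variance of inductive means of bounded i.i.d. variables\<close>

lemma (in prob_space) bounded_L1_variable:
  fixes X :: "'a \<Rightarrow> 'h::{metric_space, second_countable_topology}"
  assumes [measurable]: "X \<in> borel_measurable M" and "\<And>\<omega>. dist p (X \<omega>) \<le> R"
  shows "L1_variable M X"
  unfolding L1_variable_def
  using assms by (auto intro!: exI[of _ p] integrable_const_bound[where B=R] simp: dist_commute)

lemma (in prob_space) integrable_dist_sq_bounded:
  fixes S T :: "'a \<Rightarrow> 'h::{metric_space, second_countable_topology}"
  assumes [measurable]: "S \<in> borel_measurable M" "T \<in> borel_measurable M"
    and "\<And>\<omega>. dist p (S \<omega>) \<le> A" "\<And>\<omega>. dist p (T \<omega>) \<le> B"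
  shows "integrable M (\<lambda>\<omega>. (dist (S \<omega>) (T \<omega>))\<^sup>2)"
proof (rule integrable_const_bound[where B="(A + B)\<^sup>2"])
  have "dist (S \<omega>) (T \<omega>) \<le> A + B" for \<omega>
    using assms(3,4)[of \<omega>] dist_triangle[of "S \<omega>" "T \<omega>" p] by (simp add: dist_commute)
  then show "AE \<omega> in M. norm ((dist (S \<omega>) (T \<omega>))\<^sup>2) \<le> (A + B)\<^sup>2"
    by (auto intro!: power_mono)
qed measurable

lemma barycenter_distr_cong:
  fixes X Y :: "'w \<Rightarrow> 'h::{metric_space, second_countable_topology}"
  assumes [measurable]: "X \<in> borel_measurable M" "Y \<in> borel_measurable M"
    and eq: "distr M borel X = distr M borel Y"
  shows "barycenter M X = barycenter M Y"
proof -
  have "(\<integral>\<omega>. ((dist z (X \<omega>))\<^sup>2 - (dist y (X \<omega>))\<^sup>2) \<partial>M)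
      = (\<integral>\<omega>. ((dist z (Y \<omega>))\<^sup>2 - (dist y (Y \<omega>))\<^sup>2) \<partial>M)" for y z
  proof -
    have "(\<integral>x. ((dist z x)\<^sup>2 - (dist y x)\<^sup>2) \<partial>distr M borel X)
        = (\<integral>x. ((dist z x)\<^sup>2 - (dist y x)\<^sup>2) \<partial>distr M borel Y)"
      by (simp only: eq)
    then show ?thesis by (simp add: integral_distr)
  qed
  then show ?thesis by (simp add: barycenter_def)
qed

text \<open>Independence makes the joint law a product, so by Fubini the variance inequality at a
  fixed point \<open>s\<close> can be integrated over the law of \<open>S\<close>.\<close>

lemma (in prob_space) variance_inequality_indep:
  fixes S Y :: "'a \<Rightarrow> 'h::{hadamard_space, second_countable_topology}"
  assumes indep: "indep_var borel S borel Y"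
    and S: "\<And>\<omega>. dist p (S \<omega>) \<le> R" and Y: "\<And>\<omega>. dist p (Y \<omega>) \<le> R"
  defines "b \<equiv> barycenter M Y"
  shows "expectation (\<lambda>\<omega>. (dist (S \<omega>) b)\<^sup>2) + expectation (\<lambda>\<omega>. (dist b (Y \<omega>))\<^sup>2)
    \<le> expectation (\<lambda>\<omega>. (dist (S \<omega>) (Y \<omega>))\<^sup>2)"
proof -
  note [measurable] = indep_var_rv1[OF indep] indep_var_rv2[OF indep]
  have L1: "L1_variable M Y" by (rule bounded_L1_variable[OF _ Y]) measurable
  let ?DS = "distr M borel S" and ?DY = "distr M borel Y"
  let ?f = "\<lambda>(s, y). (dist s y)\<^sup>2 - (dist b y)\<^sup>2"
  interpret DS: prob_space ?DS by (rule prob_space_distr) measurable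
  interpret DY: prob_space ?DY by (rule prob_space_distr) measurable
  interpret P: pair_prob_space ?DS ?DY ..
  have joint: "?DS \<Otimes>\<^sub>M ?DY = distr M (borel \<Otimes>\<^sub>M borel) (\<lambda>\<omega>. (S \<omega>, Y \<omega>))"
    using indep by (simp add: indep_var_distribution_eq)
  have int_SY: "integrable M (\<lambda>\<omega>. (dist (S \<omega>) (Y \<omega>))\<^sup>2)"
    by (rule integrable_dist_sq_bounded[OF _ _ S Y]) measurable
  have int_bY: "integrable M (\<lambda>\<omega>. (dist b (Y \<omega>))\<^sup>2)"
    by (rule integrable_dist_sq_bounded[where p=p and A="dist p b", OF _ _ _ Y]) auto
  have int_Sb: "integrable M (\<lambda>\<omega>. (dist (S \<omega>) b)\<^sup>2)"
    by (rule integrable_dist_sq_bounded[where p=p and B="dist p b", OF _ _ S]) auto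
  have int_f: "integrable (?DS \<Otimes>\<^sub>M ?DY) ?f"
    unfolding joint by (subst integrable_distr_eq) (use int_SY int_bY in auto)
  have "expectation (\<lambda>\<omega>. (dist (S \<omega>) b)\<^sup>2) = (\<integral>s. (dist s b)\<^sup>2 \<partial>?DS)"
    by (subst integral_distr) auto
  also have "\<dots> \<le> (\<integral>s. (\<integral>y. ?f (s, y) \<partial>?DY) \<partial>?DS)"
  proof (rule integral_mono)
    show "integrable ?DS (\<lambda>s. (dist s b)\<^sup>2)"
      by (subst integrable_distr_eq) (use int_Sb in auto)
    show "integrable ?DS (\<lambda>s. \<integral>y. ?f (s, y) \<partial>?DY)"
      by (rule P.integrable_fst'[OF int_f])
    show "(dist s b)\<^sup>2 \<le> (\<integral>y. ?f (s, y) \<partial>?DY)" for s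
      using variance_inequality[OF L1, of s] unfolding b_def by (subst integral_distr) auto
  qed
  also have "\<dots> = (\<integral>x. ?f x \<partial>(?DS \<Otimes>\<^sub>M ?DY))"
    by (rule P.integral_fst'[OF int_f])
  also have "\<dots> = expectation (\<lambda>\<omega>. (dist (S \<omega>) (Y \<omega>))\<^sup>2 - (dist b (Y \<omega>))\<^sup>2)"
    unfolding joint by (subst integral_distr) auto
  also have "\<dots> = expectation (\<lambda>\<omega>. (dist (S \<omega>) (Y \<omega>))\<^sup>2) - expectation (\<lambda>\<omega>. (dist b (Y \<omega>))\<^sup>2)"
    by (rule Bochner_Integration.integral_diff[OF int_SY int_bY])
  finally show ?thesis by simp
qed

text \<open>The mean is a measurable function of the index block \<open>{1..n}\<close>, which is
  disjoint from \<open>{Suc n}\<close>.\<close>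

lemma (in prob_space) inductive_mean_indep_next:
  fixes Y :: "nat \<Rightarrow> 'a \<Rightarrow> 'h::{hadamard_space, second_countable_topology}"
  assumes indep: "indep_vars (\<lambda>_. borel) Y {1..}"
  shows "indep_var borel (\<lambda>\<omega>. inductive_mean (\<lambda>i. Y i \<omega>) n) borel (Y (Suc n))"
proof -
  have "indep_var
      borel ((\<lambda>f. inductive_mean f n) \<circ> (\<lambda>\<omega>. restrict (\<lambda>i. Y i \<omega>) {1..n}))
      borel ((\<lambda>f. f (Suc n)) \<circ> (\<lambda>\<omega>. restrict (\<lambda>i. Y i \<omega>) {Suc n}))"
  proof (rule indep_var_compose[OF indep_var_restrict[OF indep]])
    have "(\<lambda>f. inductive_mean (\<lambda>i. f i) n) \<in> borel_measurable (Pi\<^sub>M {1..n} (\<lambda>_. borel :: 'h measure))"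
      by (rule measurable_inductive_mean) (rule measurable_component_singleton)
    then show "(\<lambda>f. inductive_mean f n) \<in> borel_measurable (Pi\<^sub>M {1..n} (\<lambda>_. borel :: 'h measure))"
      by simp
  qed auto
  also have "(\<lambda>f. inductive_mean f n) \<circ> (\<lambda>\<omega>. restrict (\<lambda>i. Y i \<omega>) {1..n})
      = (\<lambda>\<omega>. inductive_mean (\<lambda>i. Y i \<omega>) n)"
    by (auto simp: fun_eq_iff intro!: inductive_mean_cong)
  also have "(\<lambda>f. f (Suc n)) \<circ> (\<lambda>\<omega>. restrict (\<lambda>i. Y i \<omega>) {Suc n}) = Y (Suc n)"
    by auto
  finally show ?thesis .
qed

text \<open>CAT0 with weight \<open>?t\<close> and the independent variance inequality yield the
  recursion known from arithmetic means: the old variance is multiplied by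
  \<open>(1 - ?t)\<^sup>2\<close>, and \<open>?t\<^sup>2\<close> times the variance of one variable
  is added.\<close>

lemma (in prob_space) inductive_mean_variance:
  fixes Y :: "nat \<Rightarrow> 'a \<Rightarrow> 'h::{hadamard_space, second_countable_topology}"
  assumes indep: "indep_vars (\<lambda>_. borel) Y {1..}"
    and ident: "\<And>i. i \<ge> 1 \<Longrightarrow> distr M borel (Y i) = distr M borel (Y 1)"
    and bound: "\<And>i \<omega>. i \<ge> 1 \<Longrightarrow> dist p (Y i \<omega>) \<le> R" and "n \<ge> 1"
  defines "b \<equiv> barycenter M (Y 1)"
  shows "expectation (\<lambda>\<omega>. (dist (inductive_mean (\<lambda>i. Y i \<omega>) n) b)\<^sup>2)
    \<le> expectation (\<lambda>\<omega>. (dist b (Y 1 \<omega>))\<^sup>2) / real n"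
  using \<open>n \<ge> 1\<close>
proof (induction n rule: nat_induct_at_least)
  case (Suc n)
  have Y [measurable]: "Y i \<in> borel_measurable M" if "i \<ge> 1" for i
    using indep that by (auto simp: indep_vars_def)
  let ?t = "1 / real (Suc n)"
  define S where "S \<omega> = inductive_mean (\<lambda>i. Y i \<omega>) n" for \<omega>
  define T where "T = Y (Suc n)"
  have [measurable]: "S \<in> borel_measurable M" "T \<in> borel_measurable M"
    using Y by (auto simp: S_def[abs_def] T_def intro!: measurable_inductive_mean)
  have S: "dist p (S \<omega>) \<le> R" and T: "dist p (T \<omega>) \<le> R" for \<omega>
    using bound inductive_mean_in_cball[of p "\<lambda>i. Y i \<omega>" R n] Suc.hyps
    by (auto simp: S_def T_def)
  have bT: "barycenter M T = b"
    unfolding T_def b_def by (rule barycenter_distr_cong) (use ident[of "Suc n"] Y in auto)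
  define V where "V = expectation (\<lambda>\<omega>. (dist b (Y 1 \<omega>))\<^sup>2)"
  have VT: "expectation (\<lambda>\<omega>. (dist b (T \<omega>))\<^sup>2) = V"
  proof -
    have "(\<integral>x. (dist b x)\<^sup>2 \<partial>distr M borel T) = (\<integral>x. (dist b x)\<^sup>2 \<partial>distr M borel (Y 1))"
      unfolding T_def by (subst ident) auto
    then show ?thesis by (simp add: integral_distr V_def Y)
  qed
  have int_ST: "integrable M (\<lambda>\<omega>. (dist (S \<omega>) (T \<omega>))\<^sup>2)"
    by (rule integrable_dist_sq_bounded[OF _ _ S T]) measurable
  have int_bT: "integrable M (\<lambda>\<omega>. (dist b (T \<omega>))\<^sup>2)"
    by (rule integrable_dist_sq_bounded[where p=p and A="dist p b", OF _ _ _ T]) auto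
  have int_Sb: "integrable M (\<lambda>\<omega>. (dist (S \<omega>) b)\<^sup>2)"
    by (rule integrable_dist_sq_bounded[where p=p and B="dist p b", OF _ _ S]) auto
  have int_Sb': "integrable M (\<lambda>\<omega>. (dist (inductive_mean (\<lambda>i. Y i \<omega>) (Suc n)) b)\<^sup>2)"
    by (rule integrable_dist_sq_bounded[where p=p and A=R and B="dist p b"])
       (auto intro!: measurable_inductive_mean Y inductive_mean_in_cball bound)
  have var: "expectation (\<lambda>\<omega>. (dist (S \<omega>) b)\<^sup>2) + V \<le> expectation (\<lambda>\<omega>. (dist (S \<omega>) (T \<omega>))\<^sup>2)"
  proof -
    have "indep_var borel S borel T"
      using inductive_mean_indep_next[OF indep, of n] by (simp add: S_def[abs_def] T_def)
    from variance_inequality_indep[OF this S T] show ?thesis by (simp add: bT VT)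
  qed
  let ?a = "expectation (\<lambda>\<omega>. (dist (S \<omega>) b)\<^sup>2)"
  have "expectation (\<lambda>\<omega>. (dist (inductive_mean (\<lambda>i. Y i \<omega>) (Suc n)) b)\<^sup>2)
      \<le> expectation (\<lambda>\<omega>. (1 - ?t) * (dist (S \<omega>) b)\<^sup>2 + ?t * (dist b (T \<omega>))\<^sup>2
           - ?t * (1 - ?t) * (dist (S \<omega>) (T \<omega>))\<^sup>2)"
  proof (intro integral_mono int_Sb')
    fix \<omega>
    show "(dist (inductive_mean (\<lambda>i. Y i \<omega>) (Suc n)) b)\<^sup>2
      \<le> (1 - ?t) * (dist (S \<omega>) b)\<^sup>2 + ?t * (dist b (T \<omega>))\<^sup>2 - ?t * (1 - ?t) * (dist (S \<omega>) (T \<omega>))\<^sup>2"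
      using geo_comb_CAT0[of ?t "S \<omega>" "T \<omega>" b]
      unfolding inductive_mean_Suc[OF Suc.hyps] S_def T_def by (simp add: dist_commute)
  qed (use int_ST int_bT int_Sb in auto)
  also have "\<dots> = (1 - ?t) * ?a + ?t * V - ?t * (1 - ?t) * expectation (\<lambda>\<omega>. (dist (S \<omega>) (T \<omega>))\<^sup>2)"
    using int_ST int_bT int_Sb by (simp add: VT)
  \<comment> \<open>The CAT0 correction has a negative sign, so the lower bound \<open>var\<close>
    can be inserted; it turns the weights into their squares.\<close>
  also have "\<dots> \<le> (1 - ?t) * ?a + ?t * V - ?t * (1 - ?t) * (?a + V)"
    by (intro diff_left_mono mult_left_mono var) auto
  also have "\<dots> = (1 - ?t)\<^sup>2 * ?a + ?t\<^sup>2 * V" by (simp add: power2_eq_square algebra_simps add_divide_distrib)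
  also have "\<dots> \<le> (1 - ?t)\<^sup>2 * (V / real n) + ?t\<^sup>2 * V"
    using Suc.IH by (intro add_right_mono mult_left_mono) (auto simp: S_def V_def)
  also have "\<dots> = V / real (Suc n)"
  proof -
    have "1 - ?t = real n / real (Suc n)" by (simp add: field_simps)
    then show ?thesis using Suc.hyps
      by (simp add: power2_eq_square divide_simps) (simp add: algebra_simps)
  qed
  finally show ?case by (simp add: V_def)
qed (simp add: dist_commute)

text \<open>Markov's inequality for the squared distance. The variance of \<open>Y 1\<close> is at
  most \<open>R\<^sup>2\<close> because the second moment about the barycenter does not exceed the
  one about \<open>p\<close>.\<close>

lemma (in prob_space) inductive_mean_chebyshev:
  fixes Y :: "nat \<Rightarrow> 'a \<Rightarrow> 'h::{hadamard_space, second_countable_topology}"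
  assumes indep: "indep_vars (\<lambda>_. borel) Y {1..}"
    and ident: "\<And>i. i \<ge> 1 \<Longrightarrow> distr M borel (Y i) = distr M borel (Y 1)"
    and bound: "\<And>i \<omega>. i \<ge> 1 \<Longrightarrow> dist p (Y i \<omega>) \<le> R" and "n \<ge> 1" and c: "c > 0"
  shows "prob {\<omega> \<in> space M. dist (inductive_mean (\<lambda>i. Y i \<omega>) n) (barycenter M (Y 1)) \<ge> c}
    \<le> R\<^sup>2 / (real n * c\<^sup>2)"
proof -
  have Y [measurable]: "Y i \<in> borel_measurable M" if "i \<ge> 1" for i
    using indep that by (auto simp: indep_vars_def)
  let ?b = "barycenter M (Y 1)"
  let ?u = "\<lambda>\<omega>. (dist (inductive_mean (\<lambda>i. Y i \<omega>) n) ?b)\<^sup>2"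
  have L1: "L1_variable M (Y 1)" by (rule bounded_L1_variable[OF _ bound]) auto
  have int: "integrable M ?u"
    by (rule integrable_dist_sq_bounded[where p=p and A=R and B="dist p ?b"])
       (use \<open>n \<ge> 1\<close> in \<open>auto intro!: measurable_inductive_mean Y inductive_mean_in_cball bound\<close>)
  have int': "integrable M (\<lambda>\<omega>. (dist q (Y 1 \<omega>))\<^sup>2)" for q
    by (rule integrable_dist_sq_bounded[where p=p and A="dist p q" and B=R]) (auto intro: bound)
  have "{\<omega> \<in> space M. dist (inductive_mean (\<lambda>i. Y i \<omega>) n) ?b \<ge> c} = {\<omega> \<in> space M. ?u \<omega> \<ge> c\<^sup>2}"
    using c by (auto intro: power_mono power2_le_imp_le)
  also have "prob \<dots> \<le> expectation ?u / c\<^sup>2"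
    using c by (intro integral_Markov_inequality_measure[where A="{}"] int) auto
  also have "\<dots> \<le> (R\<^sup>2 / real n) / c\<^sup>2"
  proof (intro divide_right_mono)
    have "expectation ?u \<le> expectation (\<lambda>\<omega>. (dist ?b (Y 1 \<omega>))\<^sup>2) / real n"
      by (rule inductive_mean_variance[OF indep ident bound \<open>n \<ge> 1\<close>])
    also have "\<dots> \<le> R\<^sup>2 / real n"
    proof (intro divide_right_mono)
      have "expectation (\<lambda>\<omega>. (dist ?b (Y 1 \<omega>))\<^sup>2) \<le> expectation (\<lambda>\<omega>. (dist p (Y 1 \<omega>))\<^sup>2)"
        using barycenter_minimises[OF L1, of p] int' by simp
      also have "\<dots> \<le> expectation (\<lambda>\<omega>. R\<^sup>2)"
        by (intro integral_mono int') (auto intro!: power_mono bound)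
      finally show "expectation (\<lambda>\<omega>. (dist ?b (Y 1 \<omega>))\<^sup>2) \<le> R\<^sup>2" by (simp add: prob_space)
    qed simp
    finally show "expectation ?u \<le> R\<^sup>2 / real n" .
  qed simp
  finally show ?thesis by simp
qed

section \<open>Maximal inequality for averages of nonnegative i.i.d. variables\<close>

text \<open>The joint law is a product with equal factors \<open>D\<close>, hence invariant under
  permuting the coordinates.\<close>

lemma (in prob_space) expectation_permute_iid:
  assumes indep: "indep_vars (\<lambda>_. N) Z I"
    and ident: "\<And>i. i \<in> I \<Longrightarrow> distr M N (Z i) = D"
    and f: "f \<in> borel_measurable (Pi\<^sub>M I (\<lambda>_. N))" and \<tau>: "\<tau> permutes I"
  shows "expectation (\<lambda>\<omega>. f (\<lambda>i\<in>I. Z (\<tau> i) \<omega>)) = (expectation (\<lambda>\<omega>. f (\<lambda>i\<in>I. Z i \<omega>)) :: real)"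
proof (cases "I = {}")
  case False
  have Z [measurable]: "i \<in> I \<Longrightarrow> Z i \<in> measurable M N" for i
    using indep by (auto simp: indep_vars_def)
  let ?Z = "\<lambda>\<omega>. \<lambda>i\<in>I. Z i \<omega>"
  have sD [measurable_cong]: "sets D = sets N" using ident False by (metis sets_distr ex_in_conv)
  have pD: "prob_space D" using ident False Z by (metis prob_space_distr ex_in_conv)
  have \<tau>I: "\<tau> i \<in> I" if "i \<in> I" for i using \<tau> that by (simp add: permutes_in_image)
  have sPi: "sets (Pi\<^sub>M I (\<lambda>_. D)) = sets (Pi\<^sub>M I (\<lambda>_. N))"
    by (rule sets_PiM_cong) (auto simp: sD)
  have mZ: "?Z \<in> measurable M (Pi\<^sub>M I (\<lambda>_. N))" by measurable
  have P: "distr M (Pi\<^sub>M I (\<lambda>_. N)) ?Z = Pi\<^sub>M I (\<lambda>_. D)"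
    using indep_vars_iff_distr_eq_PiM'[THEN iffD1, OF False Z indep] ident
    by (simp cong: PiM_cong)
  have m\<tau>: "(\<lambda>z. \<lambda>i\<in>I. z (\<tau> i)) \<in> measurable (Pi\<^sub>M I (\<lambda>_. N)) (Pi\<^sub>M I (\<lambda>_. N))"
    using \<tau>I by (intro measurable_restrict measurable_component_singleton) auto
  have re: "distr (Pi\<^sub>M I (\<lambda>_. D)) (Pi\<^sub>M I (\<lambda>_. D)) (\<lambda>z. \<lambda>i\<in>I. z (\<tau> i)) = Pi\<^sub>M I (\<lambda>_. D)"
    using distr_PiM_reindex[of I "\<lambda>_. D" \<tau> I] pD \<tau> \<tau>I by (auto simp: permutes_inj_on)
  have "expectation (\<lambda>\<omega>. f (?Z \<omega>)) = (\<integral>z. f z \<partial>Pi\<^sub>M I (\<lambda>_. D))"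
    unfolding P[symmetric] by (rule integral_distr[symmetric, OF mZ f])
  also have "\<dots> = (\<integral>z. f z \<partial>distr (Pi\<^sub>M I (\<lambda>_. D)) (Pi\<^sub>M I (\<lambda>_. D)) (\<lambda>z. \<lambda>i\<in>I. z (\<tau> i)))"
    by (simp only: re)
  also have "\<dots> = (\<integral>z. f (\<lambda>i\<in>I. z (\<tau> i)) \<partial>Pi\<^sub>M I (\<lambda>_. D))"
    using m\<tau> f by (intro integral_distr) (simp_all add: sPi cong: measurable_cong_sets)
  also have "\<dots> = expectation (\<lambda>\<omega>. f (\<lambda>i\<in>I. ?Z \<omega> (\<tau> i)))"
    unfolding P[symmetric] by (rule integral_distr[OF mZ]) (rule measurable_compose[OF m\<tau> f])
  also have "\<dots> = expectation (\<lambda>\<omega>. f (\<lambda>i\<in>I. Z (\<tau> i) \<omega>))"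
    using \<tau>I by (intro Bochner_Integration.integral_cong arg_cong[where f=f]) (auto simp: fun_eq_iff)
  finally show ?thesis by simp
qed (simp add: restrict_def)

text \<open>The event that \<open>n\<close> is the last time up to \<open>N\<close> at which the average exceeds \<open>c\<close> is symmetric in the
  first \<open>n\<close> variables, so that \<open>Z 1\<close> and the average of the first \<open>n\<close> have the same integral over it.\<close>

lemma (in prob_space) maximal_inequality_finite:
  fixes Z :: "nat \<Rightarrow> 'a \<Rightarrow> real"
  assumes indep: "indep_vars (\<lambda>_. borel) Z {1..}"
    and ident: "\<And>i. i \<ge> 1 \<Longrightarrow> distr M borel (Z i) = distr M borel (Z 1)"
    and nonneg: "\<And>i \<omega>. Z i \<omega> \<ge> 0" and int1: "integrable M (Z 1)"
  shows "c * prob {\<omega> \<in> space M. \<exists>n\<in>{1..N}. (\<Sum>i=1..n. Z i \<omega>) > c * real n} \<le> expectation (Z 1)"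
proof -
  have Z [measurable]: "i \<in> {1..n} \<Longrightarrow> Z i \<in> borel_measurable M" for i n
    using indep by (auto simp: indep_vars_def)
  have int: "integrable M (Z i)" if "i \<in> {1..N}" for i
  proof -
    have "integrable (distr M borel (Z i)) (\<lambda>x. x)"
      using int1 that by (subst ident) (auto simp: integrable_distr_eq)
    then show ?thesis using that by (simp add: integrable_distr_eq)
  qed
  define \<Phi> where "\<Phi> n z \<longleftrightarrow> (\<Sum>j=1..n. z j) > c * real n \<and> (\<forall>k\<in>{n<..N}. (\<Sum>j=1..k. z j) \<le> c * real k)"
    for n and z :: "nat \<Rightarrow> real"
  define A where "A n = {\<omega> \<in> space M. \<Phi> n (\<lambda>i. Z i \<omega>)}" for n
  have A [measurable]: "A n \<in> sets M" for n
  proof -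
    have [measurable]: "(\<lambda>\<omega>. \<Sum>j=1..k. Z j \<omega>) \<in> borel_measurable M" for k
      by (intro borel_measurable_sum Z)
    show ?thesis unfolding A_def \<Phi>_def by measurable
  qed
  have \<Phi>_cong: "\<Phi> n z = \<Phi> n z'" if "\<And>i. i \<in> {1..N} \<Longrightarrow> z i = z' i" "n \<le> N" for n z z'
  proof -
    have "(\<Sum>j=1..k. z j) = (\<Sum>j=1..k. z' j)" if "k \<le> N" for k
      using that \<open>\<And>i. i \<in> {1..N} \<Longrightarrow> z i = z' i\<close> by (intro sum.cong) auto
    then show ?thesis using that(2) unfolding \<Phi>_def by auto
  qed
  have swap: "expectation (\<lambda>\<omega>. Z i \<omega> * indicator (A n) \<omega>) = expectation (\<lambda>\<omega>. Z 1 \<omega> * indicator (A n) \<omega>)"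
    if i: "i \<in> {1..n}" and n: "n \<le> N" for i n
  proof -
    let ?\<tau> = "Transposition.transpose 1 i"
    let ?I = "{1..N}"
    \<comment> \<open>\<open>f\<close> expresses the integrand through the coordinates, so that
      exchanging the coordinates 1 and \<open>i\<close> turns \<open>Z 1\<close> into
      \<open>Z i\<close> and leaves the event alone.\<close>
    define f where "f z = z 1 * (if \<Phi> n z then 1 else 0 :: real)" for z :: "nat \<Rightarrow> real"
    have \<tau>: "?\<tau> permutes ?I" using i n by (intro permutes_swap_id) auto
    have ind: "indep_vars (\<lambda>_. borel) Z ?I"
      by (rule indep_vars_subset[OF indep]) auto
    have [measurable]: "(\<lambda>z. z j) \<in> borel_measurable (Pi\<^sub>M ?I (\<lambda>_. borel :: real measure))" if "j \<in> ?I" for j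
      using that by (rule measurable_component_singleton)
    have [measurable]: "(\<lambda>z. \<Sum>j=1..k. z j) \<in> borel_measurable (Pi\<^sub>M ?I (\<lambda>_. borel :: real measure))"
      if "k \<le> N" for k
      using that by (intro borel_measurable_sum) auto
    have f: "f \<in> borel_measurable (Pi\<^sub>M ?I (\<lambda>_. borel))"
    proof -
      have 1: "1 \<in> ?I" using i n by auto
      have "Measurable.pred (Pi\<^sub>M ?I (\<lambda>_. borel)) (\<Phi> n)"
        unfolding \<Phi>_def using n by measurable
      then show ?thesis unfolding f_def using 1 by measurable
    qed
    \<comment> \<open>\<open>\<Phi> n\<close> involves only partial sums of length at least
      \<open>n\<close>; each contains both exchanged indices, as \<open>i \<le> n\<close>.\<close>
    have inv: "\<Phi> n (\<lambda>j. z (?\<tau> j)) = \<Phi> n z" for z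
    proof -
      have "(\<Sum>j=1..k. z (?\<tau> j)) = (\<Sum>j=1..k. z j)" if "n \<le> k" for k
        using sum.permute[of ?\<tau> "{1..k}" z] permutes_swap_id[of 1 "{1..k}" i] i that
        by (simp add: comp_def)
      then show ?thesis unfolding \<Phi>_def by auto
    qed
    have "expectation (\<lambda>\<omega>. f (\<lambda>j\<in>?I. Z (?\<tau> j) \<omega>)) = expectation (\<lambda>\<omega>. f (\<lambda>j\<in>?I. Z j \<omega>))"
      by (rule expectation_permute_iid[OF ind _ f \<tau>], rule ident) simp
    moreover have "f (\<lambda>j\<in>?I. Z j \<omega>) = Z 1 \<omega> * indicator (A n) \<omega>" if "\<omega> \<in> space M" for \<omega>
    proof -
      have "\<Phi> n (\<lambda>j\<in>?I. Z j \<omega>) = \<Phi> n (\<lambda>j. Z j \<omega>)" by (rule \<Phi>_cong) (use n in auto)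
      moreover have "1 \<in> ?I" using i n by auto
      ultimately show ?thesis using that by (simp add: f_def A_def del: One_nat_def)
    qed
    moreover have "f (\<lambda>j\<in>?I. Z (?\<tau> j) \<omega>) = Z i \<omega> * indicator (A n) \<omega>" if "\<omega> \<in> space M" for \<omega>
    proof -
      have "\<Phi> n (\<lambda>j\<in>?I. Z (?\<tau> j) \<omega>) = \<Phi> n (\<lambda>j. Z (?\<tau> j) \<omega>)" by (rule \<Phi>_cong) (use n in auto)
      also have "\<dots> = \<Phi> n (\<lambda>j. Z j \<omega>)" by (rule inv)
      finally have "\<Phi> n (\<lambda>j\<in>?I. Z (?\<tau> j) \<omega>) = \<Phi> n (\<lambda>j. Z j \<omega>)" .
      moreover have "1 \<in> ?I" using i n by auto
      ultimately show ?thesis using that by (simp add: f_def A_def del: One_nat_def)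
    qed
    ultimately show ?thesis
      by (simp cong: Bochner_Integration.integral_cong)
  qed
  have int_ind: "integrable M (\<lambda>\<omega>. Z i \<omega> * indicator (A n) \<omega>)" if "i \<in> {1..N}" for i n
    using integrable_real_mult_indicator[OF A int[OF that]] .
  \<comment> \<open>On \<open>A n\<close> the sum of the first \<open>n\<close> variables exceeds
    \<open>c * n\<close>; by \<open>swap\<close> each of them contributes as much as
    \<open>Z 1\<close>, and \<open>n\<close> cancels.\<close>
  have level: "c * prob (A n) \<le> expectation (\<lambda>\<omega>. Z 1 \<omega> * indicator (A n) \<omega>)" if n: "n \<in> {1..N}" for n
  proof -
    have intA: "integrable M (\<lambda>\<omega>. c * real n * indicator (A n) \<omega>)"
      by (intro integrable_mult_right integrable_real_indicator A) (simp add: emeasure_eq_measure)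
    have "c * real n * prob (A n) = expectation (\<lambda>\<omega>. c * real n * indicator (A n) \<omega>)"
      by simp
    also have "\<dots> \<le> expectation (\<lambda>\<omega>. \<Sum>i=1..n. Z i \<omega> * indicator (A n) \<omega>)"
    proof (intro integral_mono Bochner_Integration.integrable_sum int_ind)
      fix \<omega>
      show "c * real n * indicator (A n) \<omega> \<le> (\<Sum>i=1..n. Z i \<omega> * indicator (A n) \<omega>)"
        by (auto simp: A_def \<Phi>_def indicator_def sum_distrib_right[symmetric])
    qed (use n intA in auto)
    also have "\<dots> = (\<Sum>i=1..n. expectation (\<lambda>\<omega>. Z i \<omega> * indicator (A n) \<omega>))"
      using n by (intro Bochner_Integration.integral_sum int_ind) auto
    also have "\<dots> = (\<Sum>i=1..n. expectation (\<lambda>\<omega>. Z 1 \<omega> * indicator (A n) \<omega>))"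
      using n by (intro sum.cong refl swap) auto
    also have "\<dots> = real n * expectation (\<lambda>\<omega>. Z 1 \<omega> * indicator (A n) \<omega>)" by simp
    finally have "real n * (c * prob (A n)) \<le> real n * expectation (\<lambda>\<omega>. Z 1 \<omega> * indicator (A n) \<omega>)"
      by (simp add: mult_ac)
    then show ?thesis using n by simp
  qed
  have disj: "disjoint_family_on A {1..N}"
    unfolding disjoint_family_on_def
  proof (intro ballI impI)
    \<comment> \<open>If \<open>a\<close> is the last exceedance up to \<open>N\<close>, there is
      none at the later time \<open>b\<close>.\<close>
    have lt: "A a \<inter> A b = {}" if "a < b" "b \<le> N" for a b
      using that by (force simp: A_def \<Phi>_def)
    show "A a \<inter> A b = {}" if "a \<in> {1..N}" "b \<in> {1..N}" "a \<noteq> b" for a b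
      using lt[of a b] lt[of b a] that by (cases "a < b") auto
  qed
  have cover: "{\<omega> \<in> space M. \<exists>n\<in>{1..N}. (\<Sum>i=1..n. Z i \<omega>) > c * real n} = (\<Union>n\<in>{1..N}. A n)" (is "?E = _")
  proof (intro equalityI subsetI)
    fix \<omega> assume \<omega>: "\<omega> \<in> ?E"
    define K where "K = {n\<in>{1..N}. (\<Sum>i=1..n. Z i \<omega>) > c * real n}"
    have K: "finite K" "K \<noteq> {}" using \<omega> by (auto simp: K_def)
    have max: "Max K \<in> K" using K by (rule Max_in)
    have "(\<Sum>i=1..k. Z i \<omega>) \<le> c * real k" if "k \<in> {Max K<..N}" for k
    proof -
      have "k \<notin> K" using that K(1) by (meson Max_ge greaterThanAtMost_iff leD)
      moreover have "k \<in> {1..N}" using that by simp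
      ultimately show ?thesis by (simp add: K_def not_less)
    qed
    moreover have "Max K \<in> {1..N}" "(\<Sum>i=1..Max K. Z i \<omega>) > c * real (Max K)"
      using max unfolding K_def by blast+
    ultimately have "Max K \<in> {1..N}" "\<omega> \<in> A (Max K)"
      using \<omega> unfolding A_def \<Phi>_def by blast+
    then show "\<omega> \<in> (\<Union>n\<in>{1..N}. A n)" by blast
  qed (auto simp: A_def \<Phi>_def)
  have "c * prob ?E = (\<Sum>n=1..N. c * prob (A n))"
    unfolding cover sum_distrib_left[symmetric]
    by (subst finite_measure_finite_Union[OF _ _ disj]) auto
  also have "\<dots> \<le> (\<Sum>n=1..N. expectation (\<lambda>\<omega>. Z 1 \<omega> * indicator (A n) \<omega>))"
    by (intro sum_mono level)
  also have "\<dots> = expectation (\<lambda>\<omega>. \<Sum>n=1..N. Z 1 \<omega> * indicator (A n) \<omega>)"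
    by (intro Bochner_Integration.integral_sum[symmetric] int_ind) auto
  also have "\<dots> \<le> expectation (Z 1)"
  proof (intro integral_mono int1 Bochner_Integration.integrable_sum int_ind)
    fix \<omega>
    \<comment> \<open>Disjointness lets the indicators add up to a single indicator, and
      \<open>Z 1\<close> is nonnegative.\<close>
    have "(\<Sum>n=1..N. Z 1 \<omega> * indicator (A n) \<omega>) = Z 1 \<omega> * indicator (\<Union>n\<in>{1..N}. A n) \<omega>"
      unfolding sum_distrib_left[symmetric] by (subst indicator_UN_disjoint[OF _ disj]) auto
    also have "\<dots> \<le> Z 1 \<omega>" using nonneg[of 1 \<omega>] by (simp add: indicator_def)
    finally show "(\<Sum>n=1..N. Z 1 \<omega> * indicator (A n) \<omega>) \<le> Z 1 \<omega>" .
  qed auto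
  finally show ?thesis .
qed

text \<open>The finite bound does not depend on \<open>N\<close>, so it passes to the increasing
  union by continuity from below.\<close>

lemma (in prob_space) maximal_inequality:
  fixes Z :: "nat \<Rightarrow> 'a \<Rightarrow> real"
  assumes indep: "indep_vars (\<lambda>_. borel) Z {1..}"
    and ident: "\<And>i. i \<ge> 1 \<Longrightarrow> distr M borel (Z i) = distr M borel (Z 1)"
    and nonneg: "\<And>i \<omega>. Z i \<omega> \<ge> 0" and int1: "integrable M (Z 1)" and c: "c > 0"
  shows "{\<omega> \<in> space M. \<exists>n\<ge>1. (\<Sum>i=1..n. Z i \<omega>) > c * real n} \<in> events"
    and "prob {\<omega> \<in> space M. \<exists>n\<ge>1. (\<Sum>i=1..n. Z i \<omega>) > c * real n} \<le> expectation (Z 1) / c"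
proof -
  have Z [measurable]: "i \<in> {1..n} \<Longrightarrow> Z i \<in> borel_measurable M" for i n
    using indep by (auto simp: indep_vars_def)
  show "{\<omega> \<in> space M. \<exists>n\<ge>1. (\<Sum>i=1..n. Z i \<omega>) > c * real n} \<in> events" by measurable
  define B where "B N = {\<omega> \<in> space M. \<exists>n\<in>{1..N}. (\<Sum>i=1..n. Z i \<omega>) > c * real n}" for N
  have "B N \<in> events" for N unfolding B_def by measurable
  moreover have "incseq B"
    by (rule incseq_SucI) (auto simp: B_def atLeastAtMostSuc_conv)
  ultimately have "(\<lambda>N. prob (B N)) \<longlonglongrightarrow> prob (\<Union>N. B N)"
    by (intro finite_Lim_measure_incseq) auto
  moreover have "prob (B N) \<le> expectation (Z 1) / c" for N
    using maximal_inequality_finite[OF indep ident nonneg int1, of c N] c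
    by (simp add: B_def field_simps)
  ultimately have "prob (\<Union>N. B N) \<le> expectation (Z 1) / c"
    by (intro LIMSEQ_le_const2) auto
  also have "(\<Union>N. B N) = {\<omega> \<in> space M. \<exists>n\<ge>1. (\<Sum>i=1..n. Z i \<omega>) > c * real n}"
    unfolding B_def Bex_def atLeastAtMost_iff by (blast intro: order_refl)
  finally show "prob {\<omega> \<in> space M. \<exists>n\<ge>1. (\<Sum>i=1..n. Z i \<omega>) > c * real n} \<le> expectation (Z 1) / c" .
qed

section \<open>Reduction to square indices\<close>

lemma inductive_mean_near_square:
  fixes x :: "nat \<Rightarrow> 'h::hadamard_space"
  assumes x: "\<And>i. i \<ge> 1 \<Longrightarrow> dist p (x i) \<le> R" and K: "K \<ge> 1" "K\<^sup>2 \<le> n"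
  obtains k where "k \<ge> K" "dist (inductive_mean x (k\<^sup>2)) (inductive_mean x n) \<le> 4 * R / real K"
proof
  let ?k = "floor_sqrt n"
  have R: "0 \<le> R" using x[of 1] zero_le_dist[of p "x 1"] by linarith
  show k: "?k \<ge> K" using K(2) by (simp add: le_floor_sqrtI)
  have le: "?k\<^sup>2 \<le> n" by simp
  have "n < (Suc ?k)\<^sup>2" by (rule Suc_floor_sqrt_power2_gt)
  \<comment> \<open>\<open>n\<close> lies before the next square, so at most \<open>2 * ?k\<close>
    steps separate it from \<open>?k\<^sup>2\<close>; each moves by at most
    \<open>2 * R / ?k\<^sup>2\<close>, in total \<open>4 * R / ?k\<close>.\<close>
  then have j: "n - ?k\<^sup>2 \<le> 2 * ?k" by (simp add: power2_eq_square)
  have k1: "?k\<^sup>2 \<ge> 1" using k K(1) by (intro one_le_power) linarith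
  have "dist (inductive_mean x (?k\<^sup>2)) (inductive_mean x (?k\<^sup>2 + (n - ?k\<^sup>2)))
      \<le> real (n - ?k\<^sup>2) * (2 * R / real (?k\<^sup>2))"
    by (rule inductive_mean_drift[of p, OF x k1])
  also have "\<dots> \<le> real (2 * ?k) * (2 * R / real (?k\<^sup>2))"
  proof (intro mult_right_mono)
    show "real (n - ?k\<^sup>2) \<le> real (2 * ?k)" using j by (rule of_nat_mono)
  qed (use R in simp)
  also have "\<dots> = 4 * R / real ?k" using k K(1) by (simp add: power2_eq_square)
  also have "\<dots> \<le> 4 * R / real K" using k K(1) R by (intro frac_le) auto
  finally show "dist (inductive_mean x (?k\<^sup>2)) (inductive_mean x n) \<le> 4 * R / real K"
    using le by simp
qed

text \<open>Along squares the Chebyshev bounds are of order \<open>1 / k\<^sup>2\<close>, hence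
  summable, and the union bound applies.\<close>

lemma (in prob_space) inductive_mean_squares_tail:
  fixes Y :: "nat \<Rightarrow> 'a \<Rightarrow> 'h::{hadamard_space, second_countable_topology}"
  assumes indep: "indep_vars (\<lambda>_. borel) Y {1..}"
    and ident: "\<And>i. i \<ge> 1 \<Longrightarrow> distr M borel (Y i) = distr M borel (Y 1)"
    and bound: "\<And>i \<omega>. i \<ge> 1 \<Longrightarrow> dist p (Y i \<omega>) \<le> R" and K: "K \<ge> 2" and c: "c > 0"
  defines "G \<equiv> {\<omega> \<in> space M. \<exists>k\<ge>K. dist (inductive_mean (\<lambda>i. Y i \<omega>) (k\<^sup>2)) (barycenter M (Y 1)) \<ge> c}"
  shows "G \<in> events" and "prob G \<le> R\<^sup>2 / (c\<^sup>2 * (real K - 1))"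
proof -
  have Y [measurable]: "Y i \<in> borel_measurable M" if "i \<ge> 1" for i
    using indep that by (auto simp: indep_vars_def)
  have [measurable]: "(\<lambda>\<omega>. inductive_mean (\<lambda>i. Y i \<omega>) n) \<in> borel_measurable M" for n
    by (rule measurable_inductive_mean) (use Y in auto)
  let ?b = "barycenter M (Y 1)"
  define A where "A i = {\<omega> \<in> space M. dist (inductive_mean (\<lambda>i. Y i \<omega>) ((K + i)\<^sup>2)) ?b \<ge> c}" for i
  \<comment> \<open>The telescoping majorant: \<open>1 / x\<^sup>2\<close> is at most
    \<open>1 / (x - 1) - 1 / x\<close>. With \<open>K \<ge> 2\<close> no denominator vanishes, and
    the sum is \<open>h 0\<close>, that is \<open>1 / (K - 1)\<close>.\<close>
  define h where "h i = 1 / (real (K + i) - 1)" for i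
  have A [measurable]: "A i \<in> events" for i unfolding A_def by measurable
  have G: "G = (\<Union>i. A i)"
    unfolding G_def A_def using le_iff_add[of K] by auto
  show "G \<in> events" unfolding G by measurable
  have le: "prob (A i) \<le> R\<^sup>2 / c\<^sup>2 * (h i - h (Suc i))" for i
  proof -
    have "prob (A i) \<le> R\<^sup>2 / (real ((K + i)\<^sup>2) * c\<^sup>2)"
      unfolding A_def using K by (intro inductive_mean_chebyshev[OF indep ident bound _ c]) (auto simp: Suc_le_eq)
    also have "\<dots> = R\<^sup>2 / c\<^sup>2 * (1 / (real (K + i))\<^sup>2)" by simp
    also have "\<dots> \<le> R\<^sup>2 / c\<^sup>2 * (h i - h (Suc i))"
    proof (intro mult_left_mono)
      have "1 / x\<^sup>2 \<le> 1 / (x - 1) - 1 / x" if "x > 1" for x :: real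
        using that by (simp add: field_simps power2_eq_square)
      from this[of "real (K + i)"] show "1 / (real (K + i))\<^sup>2 \<le> h i - h (Suc i)"
        using K by (simp add: h_def)
    qed simp
    finally show ?thesis .
  qed
  have h0: "h \<longlonglongrightarrow> 0"
  proof (rule tendsto_sandwich[of "\<lambda>_. 0" _ _ "\<lambda>i. 1 / real (Suc i)"])
    have "1 / (real (K + i) - 1) \<le> 1 / real (Suc i)" for i
      using K by (intro divide_left_mono) auto
    then show "\<forall>\<^sub>F i in sequentially. h i \<le> 1 / real (Suc i)"
      by (auto simp: h_def)
    show "\<forall>\<^sub>F i in sequentially. 0 \<le> h i" using K by (auto simp: h_def)
    show "(\<lambda>i. 1 / real (Suc i)) \<longlonglongrightarrow> 0" by (rule LIMSEQ_Suc[OF lim_1_over_n])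
  qed simp
  have sums: "(\<lambda>i. R\<^sup>2 / c\<^sup>2 * (h i - h (Suc i))) sums (R\<^sup>2 / c\<^sup>2 * (h 0 - 0))"
    by (intro sums_mult telescope_sums' h0)
  have summ: "summable (\<lambda>i. prob (A i))"
    by (rule summable_comparison_test'[OF sums_summable[OF sums], of 0]) (use le in simp)
  have "prob G \<le> (\<Sum>i. prob (A i))"
    unfolding G by (rule finite_measure_subadditive_countably[OF _ summ]) auto
  also have "\<dots> \<le> (\<Sum>i. R\<^sup>2 / c\<^sup>2 * (h i - h (Suc i)))"
    by (intro suminf_le le summ sums_summable[OF sums])
  also have "\<dots> = R\<^sup>2 / (c\<^sup>2 * (real K - 1))"
    using sums_unique[OF sums] by (simp add: h_def)
  finally show "prob G \<le> R\<^sup>2 / (c\<^sup>2 * (real K - 1))" .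
qed

section \<open>Truncation and the final estimate\<close>

lemma (in prob_space) ident_distr_compose:
  assumes X: "\<And>i. i \<ge> 1 \<Longrightarrow> X i \<in> measurable M N" and f: "f \<in> measurable N L"
    and ident: "\<And>i. i \<ge> 1 \<Longrightarrow> distr M N (X i) = distr M N (X (1::nat))" and "i \<ge> 1"
  shows "distr M L (\<lambda>\<omega>. f (X i \<omega>)) = distr M L (\<lambda>\<omega>. f (X 1 \<omega>))"
proof -
  have "distr (distr M N (X i)) L f = distr (distr M N (X 1)) L f"
    using ident[OF \<open>i \<ge> 1\<close>] by (simp only:)
  then show ?thesis using X[OF \<open>i \<ge> 1\<close>] X[of 1] f by (simp add: distr_distr comp_def)
qed

theorem theorem3p4:
  fixes M :: "'w measure"
    and X :: "nat \<Rightarrow> 'w \<Rightarrow> 'h::{hadamard_space, second_countable_topology}"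
    and p :: 'h and \<epsilon> :: real and m :: nat
  assumes "prob_space M"
    and indep: "prob_space.indep_vars M (\<lambda>_. borel) X {1..}"
    and ident: "\<And>i. i \<ge> 1 \<Longrightarrow> distr M borel (X i) = distr M borel (X 1)"
    and L1: "\<And>i. i \<ge> 1 \<Longrightarrow> L1_variable M (X i)"
    and "\<epsilon> > 0" and "m \<ge> 1"
  shows "measure M {\<omega> \<in> space M.
           (SUP n\<in>{m..}. ereal (dist (inductive_mean (\<lambda>i. X i \<omega>) n) (barycenter M (X 1)))) > ereal \<epsilon>}
         \<le> 6 / \<epsilon> * (sqrt (\<integral>\<omega>. dist p (X 1 \<omega>) \<partial>M) / real m powr (1/2)
                    + tail_expectation M p (X 1) (real m powr (1/8)))
           + 72 / (min (\<epsilon>\<^sup>2) 1 * real m powr (1/4))"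
proof -
  interpret prob_space M by fact
  let ?s = "\<lambda>n \<omega>. inductive_mean (\<lambda>i. X i \<omega>) n"
  let ?bX = "barycenter M (X 1)"
  let ?E = "{\<omega> \<in> space M. (SUP n\<in>{m..}. ereal (dist (?s n \<omega>) ?bX)) > ereal \<epsilon>}"
  define q where "q = real m powr (1/8)"
  define T where "T = tail_expectation M p (X 1) q"
  define D where "D = sqrt (\<integral>\<omega>. dist p (X 1 \<omega>) \<partial>M) / real m powr (1/2)"
  define C where "C = 72 / (min (\<epsilon>\<^sup>2) 1 * q\<^sup>2)"
  have q: "q > 0" using \<open>m \<ge> 1\<close> by (simp add: q_def)
  have q2: "real m powr (1/4) = q\<^sup>2"
    using \<open>m \<ge> 1\<close> by (simp add: q_def power2_eq_square powr_add[symmetric])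
  \<comment> \<open>In terms of \<open>q\<close> all powers of \<open>m\<close> become integral:
    \<open>m\<close> is the eighth power of \<open>q\<close> and its square root is
    \<open>q ^ 4\<close>.\<close>
  have q8: "real m = (q ^ 4)\<^sup>2"
  proof -
    have "(q ^ 4)\<^sup>2 = q powr real 8" using q by (simp add: powr_realpow flip: power_mult)
    also have "\<dots> = real m" using \<open>m \<ge> 1\<close> by (simp add: q_def powr_powr)
    finally show ?thesis ..
  qed
  have D: "D \<ge> 0" by (simp add: D_def)
  have T: "T \<ge> 0" by (auto simp: T_def tail_expectation_def intro!: integral_nonneg_AE)
  have C: "C \<ge> 0" by (simp add: C_def)
  have "prob ?E \<le> 6 / \<epsilon> * (D + T) + C"
  proof (cases "6 / \<epsilon> * (D + T) + C \<ge> 1")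
    case True
    then show ?thesis using prob_le_1[of ?E] by linarith
  next
    case False
    have "0 \<le> 6 / \<epsilon> * D" "0 \<le> 6 / \<epsilon> * T" using D T \<open>\<epsilon> > 0\<close> by auto
    moreover have "6 / \<epsilon> * (D + T) = 6 / \<epsilon> * D + 6 / \<epsilon> * T" by (rule distrib_left)
    \<comment> \<open>All summands are nonnegative, so a sum below 1 bounds each of them. The bound
      on \<open>T\<close> controls the barycenter shift, the one on \<open>C\<close> makes
      \<open>q\<close> and \<open>\<epsilon> * q\<close> large.\<close>
    ultimately have T1: "6 / \<epsilon> * T < 1" and C1: "C < 1"
      using False C by linarith+
    have T\<epsilon>: "T \<le> \<epsilon> / 6" using T1 \<open>\<epsilon> > 0\<close> by (simp add: field_simps)
    have "72 < min (\<epsilon>\<^sup>2) 1 * q\<^sup>2"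
      using C1 q \<open>\<epsilon> > 0\<close> by (simp add: C_def divide_less_eq)
    also have "min (\<epsilon>\<^sup>2) 1 * q\<^sup>2 \<le> 1 * q\<^sup>2" by (intro mult_right_mono) auto
    finally have q72: "72 < q\<^sup>2" by simp
    have "72 < min (\<epsilon>\<^sup>2) 1 * q\<^sup>2" by fact
    also have "min (\<epsilon>\<^sup>2) 1 * q\<^sup>2 \<le> \<epsilon>\<^sup>2 * q\<^sup>2" by (intro mult_right_mono) auto
    finally have "8\<^sup>2 < (\<epsilon> * q)\<^sup>2" by (simp add: power_mult_distrib)
    then have \<epsilon>q: "8 < \<epsilon> * q" using q \<open>\<epsilon> > 0\<close> by (intro power2_less_imp_less[of 8]) auto
    \<comment> \<open>Up to rounding \<open>K\<close> is the square root of \<open>m\<close>, that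
      is \<open>q ^ 4\<close>; \<open>Kq\<close> records the rounding error.\<close>
    define K where "K = floor_sqrt m"
    have Km: "K\<^sup>2 \<le> m" by (simp add: K_def)
    have "real m < (real (Suc K))\<^sup>2"
      using Suc_floor_sqrt_power2_gt[of m] unfolding K_def of_nat_power[symmetric] of_nat_less_iff .
    then have "q ^ 4 < real (Suc K)"
      unfolding q8 by (rule power2_less_imp_less) simp
    then have Kq: "q ^ 4 < real K + 1" by simp
    have q4: "q ^ 4 \<ge> 72 * q\<^sup>2"
      using mult_right_mono[of 72 "q\<^sup>2" "q\<^sup>2"] q72 by (simp add: power2_eq_square power4_eq_xxxx)
    have K2: "K \<ge> 2" using Kq q4 q72 by linarith

    define R where "R = q"
    define trunc where "trunc x = (if dist p x < R then x else p)" for x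
    define excess where "excess x = dist p x * indicator {x. dist p x \<ge> R} x" for x
    define Y where "Y i \<omega> = trunc (X i \<omega>)" for i \<omega>
    define Z where "Z i \<omega> = excess (X i \<omega>)" for i \<omega>
    let ?sY = "\<lambda>n \<omega>. inductive_mean (\<lambda>i. Y i \<omega>) n"
    let ?bY = "barycenter M (Y 1)"
    have [measurable]: "trunc \<in> borel_measurable borel" "excess \<in> borel_measurable borel"
      unfolding trunc_def excess_def by measurable
    have X [measurable]: "X i \<in> borel_measurable M" if "i \<ge> 1" for i
      using indep that by (auto simp: indep_vars_def)
    \<comment> \<open>Truncated points are sent to \<open>p\<close> itself, so the displacement is
      exactly the excess, whose mean is the tail expectation.\<close>
    have dXY: "dist (X i \<omega>) (Y i \<omega>) = Z i \<omega>" for i \<omega>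
      by (simp add: Y_def Z_def trunc_def excess_def dist_commute)
    have bound: "dist p (Y i \<omega>) \<le> R" for i \<omega>
      using q by (simp add: Y_def trunc_def R_def)
    have indepY: "indep_vars (\<lambda>_. borel) Y {1..}" and indepZ: "indep_vars (\<lambda>_. borel) Z {1..}"
      unfolding Y_def[abs_def] Z_def[abs_def]
      by (intro indep_vars_compose2[OF indep]; measurable)+
    have identY: "distr M borel (Y i) = distr M borel (Y 1)"
      and identZ: "distr M borel (Z i) = distr M borel (Z 1)" if "i \<ge> 1" for i
      unfolding Y_def[abs_def] Z_def[abs_def]
      by (rule ident_distr_compose[where X=X and N=borel, OF X _ ident that]; simp)+
    have ET: "expectation (Z 1) = T"
      unfolding T_def R_def[symmetric] tail_expectation_def Z_def excess_def
      by (intro Bochner_Integration.integral_cong) (auto simp: indicator_def)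
    have L1Y: "L1_variable M (Y 1)"
      by (rule bounded_L1_variable[OF _ bound]) (simp add: Y_def[abs_def])
    have intZ: "integrable M (Z 1)"
    proof (rule Bochner_Integration.integrable_bound[OF L1_variable_integrable[OF L1[of 1], of p]])
      show "AE \<omega> in M. norm (Z 1 \<omega>) \<le> norm (dist p (X 1 \<omega>))"
        by (auto simp: Z_def excess_def indicator_def)
    qed (auto simp: Z_def[abs_def])
    have bXY: "dist ?bX ?bY \<le> \<epsilon> / 6"
      using dist_barycenter_le[OF L1[of 1] L1Y] T\<epsilon>
      unfolding dXY ET by (rule order_trans) simp

    \<comment> \<open>The budget for \<open>\<epsilon>\<close>: \<open>\<epsilon> / 6\<close> for
      the barycenter shift, \<open>\<epsilon> / 6\<close> for the drift between squares,
      \<open>\<epsilon> / 3\<close> for the means of \<open>Y\<close> at squares (event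
      \<open>G\<close>) and \<open>\<epsilon> / 3\<close> for the truncation error (event
      \<open>H\<close>).\<close>
    define G where "G = {\<omega> \<in> space M. \<exists>k\<ge>K. dist (?sY (k\<^sup>2) \<omega>) ?bY \<ge> \<epsilon> / 3}"
    define H where "H = {\<omega> \<in> space M. \<exists>n\<ge>1. (\<Sum>i=1..n. Z i \<omega>) > \<epsilon> / 3 * real n}"
    have G: "G \<in> events" "prob G \<le> R\<^sup>2 / ((\<epsilon> / 3)\<^sup>2 * (real K - 1))"
      unfolding G_def using \<open>\<epsilon> > 0\<close>
      by (intro inductive_mean_squares_tail[OF indepY identY bound K2]; simp)+
    have Z0: "Z i \<omega> \<ge> 0" for i \<omega> by (simp add: Z_def excess_def)
    have H: "H \<in> events" "prob H \<le> T / (\<epsilon> / 3)"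
      unfolding H_def ET[symmetric] using \<open>\<epsilon> > 0\<close>
      by (intro maximal_inequality[OF indepZ identZ Z0 intZ]; simp)+
    have "?E \<subseteq> G \<union> H"
    proof
      fix \<omega> assume \<omega>: "\<omega> \<in> ?E"
      then obtain n where n: "n \<ge> m" "dist (?s n \<omega>) ?bX > \<epsilon>"
        by (auto simp: less_SUP_iff)
      have n1: "n \<ge> 1" using n \<open>m \<ge> 1\<close> by simp
      show "\<omega> \<in> G \<union> H"
      proof (cases "\<omega> \<in> G")
        case notG: False
        obtain k where k: "k \<ge> K" "dist (?sY (k\<^sup>2) \<omega>) (?sY n \<omega>) \<le> 4 * R / real K"
          using inductive_mean_near_square[of p "\<lambda>i. Y i \<omega>" R K n] bound K2 Km n by auto
        \<comment> \<open>The claim amounts to \<open>24 * q \<le> \<epsilon> * K\<close>; it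
          follows from \<open>3 * q\<^sup>2 \<le> K\<close> and
          \<open>8 < \<epsilon> * q\<close>.\<close>
        have "4 * R / real K \<le> \<epsilon> / 6"
        proof -
          have "3 * q\<^sup>2 \<le> real K" using Kq q4 q72 by linarith
          then have "24 * q\<^sup>2 \<le> 8 * real K" by simp
          also have "\<dots> \<le> \<epsilon> * q * real K" using \<epsilon>q by (intro mult_right_mono) auto
          finally have "q * (24 * q) \<le> q * (\<epsilon> * real K)" by (simp add: power2_eq_square mult_ac)
          then have "24 * q \<le> \<epsilon> * real K" using q by simp
          then show ?thesis using K2 by (simp add: R_def field_simps)
        qed
        moreover have "dist (?sY (k\<^sup>2) \<omega>) ?bY < \<epsilon> / 3"
          using notG \<omega> k(1) unfolding G_def mem_Collect_eq by (meson not_le)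
        ultimately have "dist (?sY n \<omega>) ?bY < \<epsilon> / 2"
          using k dist_triangle[of "?sY n \<omega>" ?bY "?sY (k\<^sup>2) \<omega>"] by (simp add: dist_commute)
        \<comment> \<open>Of a total above \<open>\<epsilon>\<close>, at most
          \<open>\<epsilon> / 2 + \<epsilon> / 6\<close> is accounted for, so the truncation error
          must carry the rest.\<close>
        then have "\<epsilon> / 3 < dist (?s n \<omega>) (?sY n \<omega>)"
          using n(2) bXY dist_triangle[of "?s n \<omega>" ?bX "?sY n \<omega>"] dist_triangle[of "?sY n \<omega>" ?bX ?bY]
          by (simp add: dist_commute)
        then have "\<epsilon> / 3 * real n < real n * dist (?s n \<omega>) (?sY n \<omega>)"
          using n1 by (simp add: mult.commute)
        also have "\<dots> \<le> (\<Sum>i=1..n. Z i \<omega>)"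
          using dist_inductive_mean_le[OF n1, of "\<lambda>i. X i \<omega>" "\<lambda>i. Y i \<omega>"] by (simp only: dXY)
        finally show ?thesis using \<omega> n1 by (auto simp: H_def)
      qed simp
    qed
    \<comment> \<open>Monotonicity asks for measurability of the larger set
      \<open>G \<union> H\<close>, which was obtained above.\<close>
    then have "prob ?E \<le> prob (G \<union> H)"
      using G H by (intro finite_measure_mono) auto
    also have "\<dots> \<le> prob G + prob H"
      using G H by (intro measure_Un_le)
    also have "\<dots> \<le> C + 6 / \<epsilon> * (D + T)"
    proof (rule add_mono)
      \<comment> \<open>The bound for \<open>G\<close> reduces to
        \<open>q ^ 4 \<le> 8 * (K - 1)\<close>, where 8 is 72 divided by the 9 coming from the
        threshold \<open>\<epsilon> / 3\<close>. It holds because \<open>K\<close> exceeds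
        \<open>q ^ 4 - 1\<close> and \<open>q\<close> is large.\<close>
      have "8 * (real K - 1) = 8 * real K - 8" by simp
      then have "q ^ 4 \<le> 8 * (real K - 1)" using Kq q4 q72 by linarith
      then have "q\<^sup>2 * q\<^sup>2 * 9 \<le> 72 * (real K - 1)" by (simp add: power2_eq_square power4_eq_xxxx)
      then have "9 * q\<^sup>2 / (real K - 1) \<le> 72 / q\<^sup>2"
        using q K2 by (simp add: divide_le_eq le_divide_eq mult_ac)
      then have "9 * q\<^sup>2 / (real K - 1) / \<epsilon>\<^sup>2 \<le> 72 / q\<^sup>2 / \<epsilon>\<^sup>2" by (rule divide_right_mono) simp
      moreover have "R\<^sup>2 / ((\<epsilon> / 3)\<^sup>2 * (real K - 1)) = 9 * q\<^sup>2 / (real K - 1) / \<epsilon>\<^sup>2"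
        by (simp add: R_def power_divide mult.commute)
      ultimately have "R\<^sup>2 / ((\<epsilon> / 3)\<^sup>2 * (real K - 1)) \<le> 72 / (\<epsilon>\<^sup>2 * q\<^sup>2)"
        by (simp add: mult.commute)
      also have "\<dots> \<le> C"
        unfolding C_def using q \<open>\<epsilon> > 0\<close> by (intro divide_left_mono mult_right_mono) auto
      finally show "prob G \<le> C" using G by linarith
      \<comment> \<open>The threshold \<open>\<epsilon> / 3\<close> costs a factor 3, which stays
        within the allowed 6.\<close>
      have "T / (\<epsilon> / 3) = 3 / \<epsilon> * T" by simp
      also have "\<dots> \<le> 6 / \<epsilon> * (D + T)"
        using D T \<open>\<epsilon> > 0\<close> by (intro mult_mono divide_right_mono) auto
      finally show "prob H \<le> 6 / \<epsilon> * (D + T)" using H by linarith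
    qed
    finally show ?thesis by simp
  qed
  then show ?thesis by (simp only: C_def D_def T_def q_def[symmetric] q2)
qed

end
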